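(* Let $Y$ be a separable complex Banach space and $Y_1\subset Y_2\subset Y_3\subset\cdots$ an increasing sequence of finite dimensional subspaces of $Y$ whose union is dense in $Y$. Set $X=(\sum_n Y_n)_1$, the $\ell_1$ sum of the spaces $Y_n$. Let $H$ denote either the algebra $A_u$ or the algebra $H^\infty$ (the same choice for $X$ and for $Y$). If $H(B_X)$ satisfies the cluster value theorem at every $x^{**}$ in the closed unit ball of $X^{**}$, then $H(B_Y)$ satisfies the cluster value theorem at every $y^{**}$ in the closed unit ball of $Y^{**}$.
   Context: All Banach spaces are complex. For a Banach space $X$, $B_X$ denotes its open unit ball. $H^\infty(B_X)$ is the Banach algebra (sup norm over $B_X$, pointwise operations) of all bounded analytic functions $f:B_X\to\mathbb{C}$, and $A_u(B_X)$ is the subalgebra of those $f\in H^\infty(B_X)$ that are uniformly continuous on $B_X$. Elements of $X^*$ are regarded as elements of these algebras by restriction to $B_X$. For finite dimensional (more generally Banach) spaces $Y_n$, $(\sum_n Y_n)_1$ is the Banach space of all sequences $(z_n)_n$ with $z_n\in Y_n$ and $\|(z_n)_n\|=\sum_n\|z_n\|<\infty$. Let $H(B_X)$ be one of the two algebras and let $x^{**}$ be in the closed unit ball of $X^{**}$. For $f\in H(B_X)$, the cluster set $Cl_{B_X}(f,x^{**})\subset\mathbb{C}$ is the set of all limits of $f(x_\alpha)$ along nets $(x_\alpha)$ in $B_X$ that converge to $x^{**}$ in the weak$^*$ topology of $X^{**}$. $M_{x^{**}}(B_X)$ is the set of (nonzero) multiplicative linear functionals $\tau$ on $H(B_X)$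 such that $\tau(x^* )=\langle x^{**},x^*\rangle$ for all $x^*\in X^*$. One says that $H(B_X)$ satisfies the cluster value theorem at $x^{**}$ if for every $f\in H(B_X)$ one has $\{\tau(f):\tau\in M_{x^{**}}(B_X)\}\subset Cl_{B_X}(f,x^{**})$. *)

theory Defs
  imports "HOL-Analysis.Analysis"
begin

section \<open>Complex normed spaces and complex Banach spaces\<close>

class complex_normed_vector = real_normed_vector +
  fixes scaleC :: "complex \<Rightarrow> 'a \<Rightarrow> 'a"  (infixr "*\<^sub>C" 75)
  assumes scaleC_add_right: "a *\<^sub>C (x + y) = a *\<^sub>C x + a *\<^sub>C y"
    and scaleC_add_left: "(a + b) *\<^sub>C x = a *\<^sub>C x + b *\<^sub>C x"
    and scaleC_scaleC: "a *\<^sub>C b *\<^sub>C x = (a * b) *\<^sub>C x"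
    and scaleC_of_real: "complex_of_real r *\<^sub>C x = r *\<^sub>R x"
    and norm_scaleC: "norm (a *\<^sub>C x) = cmod a * norm x"

class cbanach = complex_normed_vector + banach

lemma scaleC_one: "1 *\<^sub>C x = (x :: 'a :: complex_normed_vector)"
  using scaleC_of_real[of 1 x] by simp

text \<open>This provides \<open>complex_vector.subspace\<close> and \<open>complex_vector.span\<close>
  for complex scalars.\<close>

global_interpretation complex_vector:
  vector_space "scaleC :: complex \<Rightarrow> 'a \<Rightarrow> 'a :: complex_normed_vector"
  by unfold_locales
    (simp_all add: scaleC_add_right scaleC_add_left scaleC_scaleC scaleC_one)

definition finite_dim_csubspace :: "'a :: complex_normed_vector set \<Rightarrow> bool" where
  "finite_dim_csubspace V \<longleftrightarrow> (\<exists>B. finite B \<and> V = complex_vector.span B)"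


section \<open>Sums in the sense of l1\<close>

typedef (overloaded) ('a :: real_normed_vector) l1seq =
  "{z :: nat \<Rightarrow> 'a. summable (\<lambda>n. norm (z n))}"
  morphisms l1_nth Abs_l1seq
  by (rule exI[of _ "\<lambda>_. 0"]) simp

setup_lifting type_definition_l1seq

lemma summable_l1_nth: "summable (\<lambda>n. norm (l1_nth z n))"
  using l1_nth[of z] by simp

lemma summable_norm_add:
  fixes z w :: "nat \<Rightarrow> 'a :: real_normed_vector"
  assumes "summable (\<lambda>n. norm (z n))" "summable (\<lambda>n. norm (w n))"
  shows "summable (\<lambda>n. norm (z n + w n))"
  by (rule summable_comparison_test'[OF summable_add[OF assms], of 0])
    (simp add: norm_triangle_ineq)

instantiation l1seq :: (real_normed_vector) real_normed_vector
begin

lift_definition zero_l1seq :: "'a l1seq" is "\<lambda>_. 0" by simp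

lift_definition plus_l1seq :: "'a l1seq \<Rightarrow> 'a l1seq \<Rightarrow> 'a l1seq"
  is "\<lambda>z w n. z n + w n"
  by (rule summable_norm_add)

lift_definition uminus_l1seq :: "'a l1seq \<Rightarrow> 'a l1seq" is "\<lambda>z n. - z n" by simp

lift_definition minus_l1seq :: "'a l1seq \<Rightarrow> 'a l1seq \<Rightarrow> 'a l1seq"
  is "\<lambda>z w n. z n - w n"
  using summable_norm_add[of z "\<lambda>n. - w n" for z w] by simp

lift_definition scaleR_l1seq :: "real \<Rightarrow> 'a l1seq \<Rightarrow> 'a l1seq"
  is "\<lambda>r z n. r *\<^sub>R z n"
  by (simp add: summable_mult)

lift_definition norm_l1seq :: "'a l1seq \<Rightarrow> real" is "\<lambda>z. \<Sum>n. norm (z n)" .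

definition dist_l1seq :: "'a l1seq \<Rightarrow> 'a l1seq \<Rightarrow> real" where
  "dist_l1seq z w = norm (z - w)"

definition sgn_l1seq :: "'a l1seq \<Rightarrow> 'a l1seq" where
  "sgn_l1seq z = inverse (norm z) *\<^sub>R z"

definition uniformity_l1seq :: "('a l1seq \<times> 'a l1seq) filter" where
  "uniformity_l1seq = (INF e\<in>{0<..}. principal {(z, w). dist z w < e})"

definition open_l1seq :: "'a l1seq set \<Rightarrow> bool" where
  "open_l1seq U \<longleftrightarrow> (\<forall>z\<in>U. \<forall>\<^sub>F (z', w) in uniformity. z' = z \<longrightarrow> w \<in> U)"

instance
proof
  fix x y z :: "'a l1seq" and a b :: real
  show "x + y + z = x + (y + z)" by transfer (simp add: add.assoc)
  show "x + y = y + x" by transfer (simp add: add.commute)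
  show "0 + x = x" by transfer simp
  show "- x + x = 0" by transfer simp
  show "x - y = x + - y" by transfer simp
  show "a *\<^sub>R (x + y) = a *\<^sub>R x + a *\<^sub>R y" by transfer (simp add: scaleR_add_right)
  show "(a + b) *\<^sub>R x = a *\<^sub>R x + b *\<^sub>R x" by transfer (simp add: scaleR_add_left)
  show "a *\<^sub>R b *\<^sub>R x = (a * b) *\<^sub>R x" by transfer simp
  show "1 *\<^sub>R x = x" by transfer simp
  show "dist x y = norm (x - y)" by (rule dist_l1seq_def)
  show "sgn x = inverse (norm x) *\<^sub>R x" by (rule sgn_l1seq_def)
  show "uniformity = (INF e\<in>{0<..}. principal {(z :: 'a l1seq, w). dist z w < e})"
    by (rule uniformity_l1seq_def)
  show "open U \<longleftrightarrow> (\<forall>z\<in>U. \<forall>\<^sub>F (z', w) in uniformity. z' = z \<longrightarrow> w \<in> U)"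
    for U :: "'a l1seq set" by (rule open_l1seq_def)
  show "norm x = 0 \<longleftrightarrow> x = 0"
    by transfer (auto simp: suminf_eq_zero_iff)
  show "norm (x + y) \<le> norm x + norm y"
  proof transfer
    fix x y :: "nat \<Rightarrow> 'a"
    assume x: "summable (\<lambda>n. norm (x n))" and y: "summable (\<lambda>n. norm (y n))"
    have "summable (\<lambda>n. norm (x n + y n))"
      by (rule summable_norm_add[OF x y])
    then have "(\<Sum>n. norm (x n + y n)) \<le> (\<Sum>n. norm (x n) + norm (y n))"
      by (intro suminf_le norm_triangle_ineq summable_add x y)
    then show "(\<Sum>n. norm (x n + y n)) \<le> (\<Sum>n. norm (x n)) + (\<Sum>n. norm (y n))"
      by (simp add: suminf_add[OF x y])
  qed
  show "norm (a *\<^sub>R x) = \<bar>a\<bar> * norm x"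
    by transfer (simp add: suminf_mult)
qed

end

lemma norm_l1_nth_le: "norm (l1_nth z n) \<le> norm z"
proof -
  have "(\<Sum>k\<in>{n}. norm (l1_nth z k)) \<le> (\<Sum>k. norm (l1_nth z k))"
    by (intro sum_le_suminf summable_l1_nth) auto
  then show ?thesis by (simp add: norm_l1seq.rep_eq)
qed

instance l1seq :: (banach) banach
proof
  fix X :: "nat \<Rightarrow> 'a l1seq"
  assume X: "Cauchy X"
  have "Cauchy (\<lambda>m. l1_nth (X m) k)" for k
  proof (rule metric_CauchyI)
    fix e :: real assume "e > 0"
    then obtain M where M: "\<And>m n. m \<ge> M \<Longrightarrow> n \<ge> M \<Longrightarrow> dist (X m) (X n) < e"
      using metric_CauchyD[OF X] by blast
    have "dist (l1_nth (X m) k) (l1_nth (X n) k) \<le> dist (X m) (X n)" for m n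
      using norm_l1_nth_le[of "X m - X n" k] by (simp add: dist_norm minus_l1seq.rep_eq)
    then show "\<exists>M. \<forall>m\<ge>M. \<forall>n\<ge>M. dist (l1_nth (X m) k) (l1_nth (X n) k) < e"
      using M by (meson order_le_less_trans)
  qed
  then have "\<forall>k. \<exists>l. (\<lambda>m. l1_nth (X m) k) \<longlonglongrightarrow> l"
    using Cauchy_convergent convergent_def by blast
  then obtain z where z: "\<And>k. (\<lambda>m. l1_nth (X m) k) \<longlonglongrightarrow> z k" by metis
  have *: "\<exists>M. \<forall>m\<ge>M. summable (\<lambda>k. norm (l1_nth (X m) k - z k)) \<and>
             (\<Sum>k. norm (l1_nth (X m) k - z k)) \<le> e" if "e > 0" for e
  proof -
    obtain M where M: "\<And>m n. m \<ge> M \<Longrightarrow> n \<ge> M \<Longrightarrow> dist (X m) (X n) < e"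
      using metric_CauchyD[OF X \<open>e > 0\<close>] by blast
    have le: "(\<Sum>k<K. norm (l1_nth (X m) k - z k)) \<le> e" if "m \<ge> M" for m K
    proof (rule tendsto_upperbound)
      show "(\<lambda>n. \<Sum>k<K. norm (l1_nth (X m) k - l1_nth (X n) k))
              \<longlonglongrightarrow> (\<Sum>k<K. norm (l1_nth (X m) k - z k))"
        by (intro tendsto_intros z)
      have "(\<Sum>k<K. norm (l1_nth (X m) k - l1_nth (X n) k)) \<le> e" if "n \<ge> M" for n
      proof -
        have "(\<Sum>k<K. norm (l1_nth (X m - X n) k)) \<le> (\<Sum>k. norm (l1_nth (X m - X n) k))"
          by (intro sum_le_suminf summable_l1_nth) auto
        also have "\<dots> = dist (X m) (X n)" by (simp add: dist_norm norm_l1seq.rep_eq)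
        also have "\<dots> \<le> e" using M[OF \<open>m \<ge> M\<close> \<open>n \<ge> M\<close>] by simp
        finally show ?thesis by (simp add: minus_l1seq.rep_eq)
      qed
      then show "\<forall>\<^sub>F n in sequentially.
          (\<Sum>k<K. norm (l1_nth (X m) k - l1_nth (X n) k)) \<le> e"
        by (auto simp: eventually_sequentially)
    qed auto
    have "summable (\<lambda>k. norm (l1_nth (X m) k - z k)) \<and>
          (\<Sum>k. norm (l1_nth (X m) k - z k)) \<le> e" if "m \<ge> M" for m
    proof -
      have s: "summable (\<lambda>k. norm (l1_nth (X m) k - z k))"
        by (rule summableI_nonneg_bounded[of _ e]) (use le[OF that] in auto)
      then show ?thesis using suminf_le_const[OF s, of e] le[OF that] by simp
    qed
    then show ?thesis by blast
  qed
  obtain m where m: "summable (\<lambda>k. norm (l1_nth (X m) k - z k))"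
    using *[of 1] by auto
  have "summable (\<lambda>k. norm (z k))"
  proof (rule summable_comparison_test'[OF summable_add[OF summable_l1_nth[of "X m"] m]])
    show "norm (norm (z k)) \<le> norm (l1_nth (X m) k) + norm (l1_nth (X m) k - z k)" for k
      using norm_triangle_ineq4[of "l1_nth (X m) k" "l1_nth (X m) k - z k"] by simp
  qed
  then have Z: "l1_nth (Abs_l1seq z) = z" by (simp add: Abs_l1seq_inverse)
  have "X \<longlonglongrightarrow> Abs_l1seq z"
  proof (rule metric_LIMSEQ_I)
    fix e :: real assume "e > 0"
    then obtain M where M: "\<forall>m\<ge>M. (\<Sum>k. norm (l1_nth (X m) k - z k)) \<le> e / 2"
      using *[of "e / 2"] by auto
    show "\<exists>M. \<forall>m\<ge>M. dist (X m) (Abs_l1seq z) < e"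
      using M \<open>e > 0\<close>
      by (intro exI[of _ M]) (force simp: dist_norm norm_l1seq.rep_eq minus_l1seq.rep_eq Z)
  qed
  then show "convergent X" by (auto simp: convergent_def)
qed

instantiation l1seq :: (complex_normed_vector) complex_normed_vector
begin

lift_definition scaleC_l1seq :: "complex \<Rightarrow> 'a l1seq \<Rightarrow> 'a l1seq"
  is "\<lambda>c z n. c *\<^sub>C z n"
  by (simp add: norm_scaleC summable_mult)

instance
proof
  fix x y :: "'a l1seq" and a b :: complex and r :: real
  show "a *\<^sub>C (x + y) = a *\<^sub>C x + a *\<^sub>C y" by transfer (simp add: scaleC_add_right)
  show "(a + b) *\<^sub>C x = a *\<^sub>C x + b *\<^sub>C x" by transfer (simp add: scaleC_add_left)
  show "a *\<^sub>C b *\<^sub>C x = (a * b) *\<^sub>C x" by transfer (simp add: scaleC_scaleC)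
  show "complex_of_real r *\<^sub>C x = r *\<^sub>R x" by transfer (simp add: scaleC_of_real)
  show "norm (a *\<^sub>C x) = cmod a * norm x" by transfer (simp add: norm_scaleC suminf_mult)
qed

end

instance l1seq :: (cbanach) cbanach ..

definition l1_sum :: "(nat \<Rightarrow> 'a :: complex_normed_vector set) \<Rightarrow> 'a l1seq set" where
  "l1_sum V = {z. \<forall>n. l1_nth z n \<in> V n}"

lemma subspace_l1_sum:
  assumes "\<And>n. complex_vector.subspace (V n)"
  shows "complex_vector.subspace (l1_sum V)"
  using assms unfolding complex_vector.subspace_def l1_sum_def
  by (auto simp: zero_l1seq.rep_eq plus_l1seq.rep_eq scaleC_l1seq.rep_eq)

lemma closed_l1_sum:
  assumes "\<And>n. closed (V n)"
  shows "closed (l1_sum V)"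
proof -
  have "continuous_on UNIV (\<lambda>z :: 'a l1seq. l1_nth z n)" for n
    unfolding continuous_on_iff
  proof safe
    fix z :: "'a l1seq" and e :: real assume "e > 0"
    then show "\<exists>d>0. \<forall>w\<in>UNIV. dist w z < d \<longrightarrow> dist (l1_nth w n) (l1_nth z n) < e"
      using norm_l1_nth_le[of "_ - z" n]
      by (auto simp: dist_norm minus_l1seq.rep_eq intro!: exI[of _ e]
               intro: order_le_less_trans)
  qed
  then have "closed (\<Inter>n. (\<lambda>z. l1_nth z n) -` V n)"
    using assms by (auto intro!: closed_INT closed_vimage)
  moreover have "l1_sum V = (\<Inter>n. (\<lambda>z. l1_nth z n) -` V n)"
    by (auto simp: l1_sum_def)
  ultimately show ?thesis by simp
qed


section \<open>Dual and bidual\<close>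

text \<open>From here on a Banach space is given as a closed complex subspace \<open>S\<close> of a type of class
  \<^class>\<open>cbanach\<close>, with the induced norm; a type \<open>'a\<close> of this class is itself the case \<open>S = UNIV\<close>.
  Functions defined on a set \<open>A\<close> only are represented by total functions vanishing outside of \<open>A\<close>,
  so that every function on \<open>A\<close> has exactly one representative and the pointwise operations
  are the pointwise operations of representatives.\<close>

definition restrict0 :: "'a set \<Rightarrow> ('a \<Rightarrow> complex) \<Rightarrow> 'a \<Rightarrow> complex" where
  "restrict0 A f = (\<lambda>x. if x \<in> A then f x else 0)"

definition dual :: "'a :: complex_normed_vector set \<Rightarrow> ('a \<Rightarrow> complex) set" where
  "dual S = {\<phi>. (\<forall>x\<in>S. \<forall>y\<in>S. \<phi> (x + y) = \<phi> x + \<phi> y) \<and>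
                (\<forall>c. \<forall>x\<in>S. \<phi> (c *\<^sub>C x) = c * \<phi> x) \<and>
                (\<exists>K. \<forall>x\<in>S. cmod (\<phi> x) \<le> K * norm x) \<and>
                (\<forall>x. x \<notin> S \<longrightarrow> \<phi> x = 0)}"

definition dual_norm :: "'a :: complex_normed_vector set \<Rightarrow> ('a \<Rightarrow> complex) \<Rightarrow> real" where
  "dual_norm S \<phi> = (SUP x\<in>{x\<in>S. norm x \<le> 1}. cmod (\<phi> x))"

definition bidual :: "'a :: complex_normed_vector set \<Rightarrow> (('a \<Rightarrow> complex) \<Rightarrow> complex) set" where
  "bidual S = {\<Phi>. (\<forall>\<phi>\<in>dual S. \<forall>\<psi>\<in>dual S. \<Phi> (\<lambda>x. \<phi> x + \<psi> x) = \<Phi> \<phi> + \<Phi> \<psi>) \<and>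
                  (\<forall>c. \<forall>\<phi>\<in>dual S. \<Phi> (\<lambda>x. c * \<phi> x) = c * \<Phi> \<phi>) \<and>
                  (\<exists>K. \<forall>\<phi>\<in>dual S. cmod (\<Phi> \<phi>) \<le> K * dual_norm S \<phi>) \<and>
                  (\<forall>\<phi>. \<phi> \<notin> dual S \<longrightarrow> \<Phi> \<phi> = 0)}"

definition bidual_norm ::
    "'a :: complex_normed_vector set \<Rightarrow> (('a \<Rightarrow> complex) \<Rightarrow> complex) \<Rightarrow> real" where
  "bidual_norm S \<Phi> = (SUP \<phi>\<in>{\<phi>\<in>dual S. dual_norm S \<phi> \<le> 1}. cmod (\<Phi> \<phi>))"

definition bidual_cball ::
    "'a :: complex_normed_vector set \<Rightarrow> (('a \<Rightarrow> complex) \<Rightarrow> complex) set" where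
  "bidual_cball S = {\<Phi>\<in>bidual S. bidual_norm S \<Phi> \<le> 1}"


section \<open>Algebras of analytic functions on the open unit ball\<close>

definition unit_ball :: "'a :: complex_normed_vector set \<Rightarrow> 'a set" where
  "unit_ball S = {x\<in>S. norm x < 1}"

text \<open>Analyticity is complex Frechet differentiability at every point of the ball, with
  derivative in the dual of \<open>S\<close>. The notion \<^const>\<open>has_derivative\<close> is not
  applicable as such, since it needs a derivative defined on the whole type.\<close>

definition analytic_on_ball ::
    "'a :: complex_normed_vector set \<Rightarrow> ('a \<Rightarrow> complex) \<Rightarrow> bool" where
  "analytic_on_ball S f \<longleftrightarrow>
     (\<forall>x\<in>unit_ball S. \<exists>D\<in>dual S.
        ((\<lambda>y. (f y - f x - D (y - x)) /\<^sub>R norm (y - x)) \<longlongrightarrow> 0) (at x within unit_ball S))"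

definition H_infinity :: "'a :: complex_normed_vector set \<Rightarrow> ('a \<Rightarrow> complex) set" where
  "H_infinity S = {f. analytic_on_ball S f \<and> bounded (f ` unit_ball S) \<and>
                      (\<forall>x. x \<notin> unit_ball S \<longrightarrow> f x = 0)}"

definition A_u :: "'a :: complex_normed_vector set \<Rightarrow> ('a \<Rightarrow> complex) set" where
  "A_u S = {f\<in>H_infinity S. uniformly_continuous_on (unit_ball S) f}"

text \<open>A name for the choice of the algebra, to be made simultaneously for several spaces.\<close>

datatype ball_algebra = Uniform_Algebra | Bounded_Algebra

fun functions_of :: "ball_algebra \<Rightarrow> 'a :: complex_normed_vector set \<Rightarrow> ('a \<Rightarrow> complex) set" where
  "functions_of Uniform_Algebra S = A_u S"
| "functions_of Bounded_Algebra S = H_infinity S"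


section \<open>Cluster values\<close>

text \<open>Nets in the ball are rendered by proper filters containing the ball; weak-star
  convergence to \<open>\<Phi>\<close> is convergence after applying each element of the dual.\<close>

definition cluster_set ::
    "'a :: complex_normed_vector set \<Rightarrow> ('a \<Rightarrow> complex) \<Rightarrow> (('a \<Rightarrow> complex) \<Rightarrow> complex)
      \<Rightarrow> complex set" where
  "cluster_set S f \<Phi> =
     {l. \<exists>F. F \<noteq> bot \<and> (\<forall>\<^sub>F x in F. x \<in> unit_ball S) \<and>
            (\<forall>\<phi>\<in>dual S. (\<phi> \<longlongrightarrow> \<Phi> \<phi>) F) \<and> (f \<longlongrightarrow> l) F}"

definition characters :: "('a \<Rightarrow> complex) set \<Rightarrow> (('a \<Rightarrow> complex) \<Rightarrow> complex) set" where
  "characters H = {\<tau>. (\<forall>f\<in>H. \<forall>g\<in>H. \<tau> (\<lambda>x. f x + g x) = \<tau> f + \<tau> g) \<and>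
                      (\<forall>c. \<forall>f\<in>H. \<tau> (\<lambda>x. c * f x) = c * \<tau> f) \<and>
                      (\<forall>f\<in>H. \<forall>g\<in>H. \<tau> (\<lambda>x. f x * g x) = \<tau> f * \<tau> g) \<and>
                      (\<exists>f\<in>H. \<tau> f \<noteq> 0) \<and>
                      (\<forall>f. f \<notin> H \<longrightarrow> \<tau> f = 0)}"

definition fiber ::
    "ball_algebra \<Rightarrow> 'a :: complex_normed_vector set \<Rightarrow> (('a \<Rightarrow> complex) \<Rightarrow> complex)
      \<Rightarrow> (('a \<Rightarrow> complex) \<Rightarrow> complex) set" where
  "fiber H S \<Phi> =
     {\<tau>\<in>characters (functions_of H S). \<forall>\<phi>\<in>dual S. \<tau> (restrict0 (unit_ball S) \<phi>) = \<Phi> \<phi>}"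

definition cluster_value_theorem_at ::
    "ball_algebra \<Rightarrow> 'a :: complex_normed_vector set \<Rightarrow> (('a \<Rightarrow> complex) \<Rightarrow> complex) \<Rightarrow> bool" where
  "cluster_value_theorem_at H S \<Phi> \<longleftrightarrow>
     (\<forall>f\<in>functions_of H S. {\<tau> f |\<tau>. \<tau> \<in> fiber H S \<Phi>} \<subseteq> cluster_set S f \<Phi>)"

end

theory Submission
  imports Defs "HOL-Complex_Analysis.Cauchy_Integral_Formula"
begin

text \<open>
  Let \<open>X\<close> be the l1 sum of the \<open>Y n\<close>. Summation \<open>Q : X \<rightarrow> 'a\<close> is a linear contraction, so
  \<open>f \<mapsto> f \<circ> Q\<close> is a homomorphism from the algebra of the ball of \<open>'a\<close> into that of the ball of
  \<open>X\<close>. To use the hypothesis on \<open>X\<close>, a character \<open>\<tau>\<close> over a point \<open>y\<close> of the bidual of \<open>'a\<close> must be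
  lifted to a character \<open>\<sigma>\<close> on the larger algebra with \<open>\<sigma> (f \<circ> Q) = \<tau> f\<close>, lying over a point of
  the unit ball of the bidual of \<open>X\<close>. It suffices to have a homomorphism \<open>T\<close> in the opposite
  direction with \<open>T (f \<circ> Q) = f\<close>; then \<open>\<sigma> = \<tau> \<circ> T\<close>.

  Let \<open>J n : Y n \<rightarrow> X\<close> be the isometric inclusion of the \<open>n\<close>-th summand, so that \<open>Q \<circ> J n\<close> is the
  identity. For \<open>y\<close> in the ball of \<open>'a\<close> choose \<open>a n \<in> Y n\<close> tending to \<open>y\<close>, which is possible
  because the \<open>Y n\<close> increase to a dense union, and put \<open>(T g) y = lim g (J n (a n))\<close> along a
  nontrivial filter on the natural numbers along which every bounded sequence converges. Since
  limits respect sums and products, \<open>T\<close> is a homomorphism, and \<open>f (Q (J n (a n))) = f (a n)\<close> tends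
  to \<open>f y\<close>.

  What remains is that \<open>T g\<close> belongs to the right algebra and does not depend on the choice of
  \<open>a\<close>. Both follow from Cauchy's estimates: for an analytic \<open>g\<close> bounded by \<open>M\<close>, the derivative at
  \<open>x\<close> and the second-order remainder of \<open>g\<close> are bounded by constants that involve only \<open>M\<close> and
  the distance of \<open>x\<close> from the sphere. Thus the functions \<open>g \<circ> J n\<close> are uniformly locally Lipschitz
  (\<open>analytic_lipschitz_bound\<close>), which gives independence of \<open>a\<close> (\<open>tendsto_ball_limit\<close>), and the
  inequality \<open>\<bar>g (x + h) - g x - D h\<bar> \<le> C \<parallel>h\<parallel>\<^sup>2\<close> passes to the limit together with the
  derivatives, so that \<open>T g\<close> is Frechet differentiable (\<open>ball_limit_in_functions_of\<close>).

  The same limit maps the dual of \<open>X\<close> linearly and without increase of norm into the dual of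
  \<open>'a\<close>; composing \<open>y\<close> with it gives the point over which \<open>\<sigma>\<close> lies. A net in the ball of
  \<open>X\<close> that realizes \<open>\<sigma> (f \<circ> Q)\<close> as a cluster value there is mapped by \<open>Q\<close> to one that realizes
  \<open>\<tau> f\<close> at \<open>y\<close> (\<open>cluster_set_pullback\<close>).
\<close>

section \<open>A filter along which bounded sequences converge\<close>

text \<open>Minimal proper filters are the ultrafilters. Zorn's lemma applies because the infimum of a
  chain of proper filters is proper: an event that holds eventually for the infimum holds
  eventually for a member of the chain.\<close>

lemma ex_minimal_filter:
  fixes F :: "'a filter"
  assumes "F \<noteq> bot"
  obtains U where "U \<le> F" "U \<noteq> bot" "\<And>G. G \<le> U \<Longrightarrow> G \<noteq> bot \<Longrightarrow> G = U"
proof -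
  define A where "A = {G. G \<noteq> bot \<and> G \<le> F}"
  have "\<exists>m\<in>A. \<forall>a\<in>A. m \<ge> a \<longrightarrow> a = m"
  proof (rule predicate_Zorn)
    show "partial_order_on A (relation_of (\<ge>) A)"
      by (auto simp: partial_order_on_def preorder_on_def refl_on_def trans_def antisym_def
          relation_of_def)
    fix C assume C: "C \<in> Chains (relation_of (\<ge>) A)"
    then have CA: "C \<subseteq> A" and lin: "\<And>G G'. G \<in> C \<Longrightarrow> G' \<in> C \<Longrightarrow> G \<le> G' \<or> G' \<le> G"
      by (auto simp: Chains_def relation_of_def)
    show "\<exists>u\<in>A. \<forall>a\<in>C. u \<le> a"
    proof (cases "C = {}")
      case True
      then show ?thesis using assms by (auto simp: A_def)
    next
      case False
      have "eventually P (Inf C) \<longleftrightarrow> (\<exists>G\<in>C. eventually P G)" for P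
        using lin by (intro eventually_Inf_base False) (metis inf.absorb1 inf.absorb2 order_refl)
      then have "Inf C \<noteq> bot"
        using CA by (auto simp: trivial_limit_def A_def)
      moreover have "Inf C \<le> F"
        using False CA by (auto simp: A_def intro: Inf_lower2)
      ultimately show ?thesis by (auto simp: A_def intro: Inf_lower)
    qed
  qed
  then show ?thesis using that unfolding A_def by (auto intro: order_trans)
qed

text \<open>An ultrafilter finer than \<open>sequentially\<close>: a bounded sequence has a cluster point along it by
  compactness, and along an ultrafilter every cluster point is a limit.\<close>

lemma ex_filter_bounded_convergent:
  obtains U :: "nat filter" where "U \<noteq> bot" "U \<le> sequentially"
    "\<And>s :: nat \<Rightarrow> complex. bounded (range s) \<Longrightarrow> \<exists>l. (s \<longlongrightarrow> l) U"
proof -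
  obtain U :: "nat filter" where U: "U \<le> sequentially" "U \<noteq> bot"
    and min: "\<And>G. G \<le> U \<Longrightarrow> G \<noteq> bot \<Longrightarrow> G = U"
    using ex_minimal_filter[OF sequentially_bot] by blast
  have ultra: "eventually P U \<or> eventually (\<lambda>x. \<not> P x) U" for P
  proof (cases "inf U (principal {x. P x}) = bot")
    case True
    then show ?thesis
      by (auto simp: trivial_limit_def eventually_inf_principal)
  next
    case False
    then have "inf U (principal {x. P x}) = U" by (intro min) auto
    then have "U \<le> principal {x. P x}" by (simp add: inf.absorb_iff1)
    then show ?thesis by (simp add: le_principal)
  qed
  have "\<exists>l. (s \<longlongrightarrow> l) U" if s: "bounded (range s)" for s :: "nat \<Rightarrow> complex"
  proof -
    have "compact (closure (range s))" using s by (simp add: compact_closure)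
    moreover have "filtermap s U \<noteq> bot"
      using U(2) by (simp add: filtermap_bot_iff)
    moreover have "eventually (\<lambda>x. x \<in> closure (range s)) (filtermap s U)"
      by (auto simp: eventually_filtermap intro!: always_eventually closure_subset[THEN subsetD])
    ultimately obtain l where l: "inf (nhds l) (filtermap s U) \<noteq> bot"
      unfolding compact_filter by blast
    have "eventually (\<lambda>n. s n \<in> N) U" if N: "open N" "l \<in> N" for N
    proof (rule ccontr)
      assume "\<not> ?thesis"
      then have "eventually (\<lambda>x. x \<notin> N) (filtermap s U)"
        using ultra[of "\<lambda>n. s n \<in> N"] by (simp add: eventually_filtermap)
      moreover have "eventually (\<lambda>x. x \<in> N) (nhds l)" using N by (rule eventually_nhds_in_open)
      ultimately have "eventually (\<lambda>_. False) (inf (nhds l) (filtermap s U))"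
        unfolding eventually_inf by blast
      then show False using l by (simp add: trivial_limit_def)
    qed
    then show ?thesis by (auto simp: tendsto_def)
  qed
  then show ?thesis using that U by blast
qed

section \<open>Cauchy estimates in the ball of a normed space\<close>

text \<open>Cauchy's inequality bounds the \<open>n\<close>-th Taylor term by \<open>M (\<bar>t\<bar> / r)^n\<close>, and for
  \<open>\<bar>t\<bar> \<le> r / 2\<close> the geometric tail from \<open>n = 2\<close> on is at most twice its first term.\<close>

lemma holomorphic_first_order_remainder:
  assumes hol: "u holomorphic_on ball 0 R" and r: "0 < r" "r < R"
    and bd: "\<And>t. cmod t = r \<Longrightarrow> cmod (u t) \<le> M"
  shows "cmod (deriv u 0) \<le> M / r"
    and "cmod t \<le> r / 2 \<Longrightarrow> cmod (u t - u 0 - deriv u 0 * t) \<le> 2 * M * (cmod t / r)\<^sup>2"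
proof -
  have M: "M \<ge> 0" using bd[of "of_real r"] r(1) by (smt (verit) norm_ge_zero norm_of_real)
  have C: "cmod ((deriv ^^ n) u 0) \<le> fact n * M / r ^ n" for n
  proof (rule Cauchy_inequality)
    show "u holomorphic_on ball 0 r" "continuous_on (cball 0 r) u"
      using r by (auto intro!: holomorphic_on_subset[OF hol] holomorphic_on_imp_continuous_on)
  qed (use r bd in auto)
  from C[of 1] show "cmod (deriv u 0) \<le> M / r" by simp
  assume t: "cmod t \<le> r / 2"
  define a where "a n = (deriv ^^ n) u 0 / fact n * t ^ n" for n
  define q where "q = cmod t / r"
  have q: "0 \<le> q" "q \<le> 1 / 2" using t r by (auto simp: q_def field_simps)
  have "a sums u t"
    using holomorphic_power_series[OF hol, of t] t r by (simp add: a_def[abs_def])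
  from sums_split_initial_segment[OF this, of 2]
  have tail: "(\<lambda>n. a (n + 2)) sums (u t - u 0 - deriv u 0 * t)"
    by (simp add: a_def numeral_2_eq_2 algebra_simps)
  have an: "cmod (a n) \<le> M * q ^ n" for n
  proof -
    have "cmod (a n) = cmod ((deriv ^^ n) u 0) / fact n * cmod t ^ n"
      by (simp add: a_def norm_mult norm_divide norm_power)
    also have "\<dots> \<le> (fact n * M / r ^ n) / fact n * cmod t ^ n"
      by (intro mult_right_mono divide_right_mono C) auto
    also have "\<dots> = M * q ^ n" by (simp add: q_def power_divide)
    finally show ?thesis .
  qed
  have geo: "(\<lambda>n. M * q\<^sup>2 * q ^ n) sums (M * q\<^sup>2 * (1 / (1 - q)))"
    using q by (intro sums_mult geometric_sums) auto
  have "cmod (\<Sum>n. a (n + 2)) \<le> (\<Sum>n. M * q\<^sup>2 * q ^ n)"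
    using an[of "_ + 2"] by (intro norm_suminf_le sums_summable[OF geo])
      (simp add: power_add algebra_simps power2_eq_square)
  also have "\<dots> = M * q\<^sup>2 * (1 / (1 - q))" using sums_unique[OF geo] by simp
  also have "\<dots> \<le> M * q\<^sup>2 * 2"
    using q M by (intro mult_left_mono) (auto simp: field_simps)
  finally show "cmod (u t - u 0 - deriv u 0 * t) \<le> 2 * M * (cmod t / r)\<^sup>2"
    using sums_unique[OF tail] by (simp add: q_def)
qed

definition has_complex_derivative_at ::
    "'a :: complex_normed_vector set \<Rightarrow> ('a \<Rightarrow> complex) \<Rightarrow> 'a \<Rightarrow> ('a \<Rightarrow> complex) \<Rightarrow> bool" where
  "has_complex_derivative_at S f x D \<longleftrightarrow> D \<in> dual S \<and>
     ((\<lambda>y. (f y - f x - D (y - x)) /\<^sub>R norm (y - x)) \<longlongrightarrow> 0) (at x within unit_ball S)"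

lemma analytic_on_ball_iff:
  "analytic_on_ball S f \<longleftrightarrow> (\<forall>x\<in>unit_ball S. \<exists>D. has_complex_derivative_at S f x D)"
  by (auto simp: analytic_on_ball_def has_complex_derivative_at_def)

lemma has_field_derivative_along_line:
  assumes S: "complex_vector.subspace S" and e: "e \<in> S" "norm e = 1" and x: "x \<in> S"
    and t0: "norm (x + t0 *\<^sub>C e) < 1"
    and D: "has_complex_derivative_at S f (x + t0 *\<^sub>C e) D"
  shows "((\<lambda>t. f (x + t *\<^sub>C e)) has_field_derivative D e) (at t0)"
proof -
  define l where "l t = x + t *\<^sub>C e" for t
  have lS: "l t \<in> S" for t
    using S e x by (simp add: l_def complex_vector.subspace_add complex_vector.subspace_scale)
  have diff: "l t - l s = (t - s) *\<^sub>C e" for t s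
    by (simp add: l_def complex_vector.scale_left_diff_distrib)
  have ndiff: "norm (l t - l s) = cmod (t - s)" for t s
    by (simp add: diff norm_scaleC e)
  have Dl: "D (l t - l t0) = (t - t0) * D e" for t
    using D e by (simp add: diff has_complex_derivative_at_def dual_def)
  have lim: "(l \<longlongrightarrow> l t0) (at t0)"
    unfolding LIM_def by (auto simp: dist_norm ndiff intro!: exI)
  have "eventually (\<lambda>t. norm (l t) < 1) (at t0)"
    using order_tendstoD(2)[OF tendsto_norm[OF lim]] t0 by (simp add: l_def)
  moreover have "eventually (\<lambda>t. t \<noteq> t0) (at t0)" by (simp add: eventually_at_filter)
  ultimately have "eventually (\<lambda>t. l t \<in> unit_ball S \<and> l t \<noteq> l t0) (at t0)"
  proof eventually_elim
    case (elim t)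
    then show ?case using ndiff[of t t0] by (auto simp: unit_ball_def lS)
  qed
  with lim have "filterlim l (at (l t0) within unit_ball S) (at t0)"
    by (auto simp: filterlim_at elim: eventually_mono)
  moreover have "((\<lambda>y. (f y - f (l t0) - D (y - l t0)) /\<^sub>R norm (y - l t0)) \<longlongrightarrow> 0)
      (at (l t0) within unit_ball S)"
    using D by (simp add: has_complex_derivative_at_def l_def)
  ultimately
  have "((\<lambda>t. (f (l t) - f (l t0) - D (l t - l t0)) /\<^sub>R norm (l t - l t0)) \<longlongrightarrow> 0) (at t0)"
    by (rule filterlim_compose[rotated])
  from tendsto_norm_zero[OF this]
  have "((\<lambda>t. cmod (f (l t) - f (l t0) - (t - t0) * D e) / cmod (t - t0)) \<longlongrightarrow> 0) (at t0)"
    by (simp add: Dl ndiff divide_inverse mult.commute)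
  then have "((\<lambda>t. cmod ((f (l t) - f (l t0)) / (t - t0) - D e)) \<longlongrightarrow> 0) (at t0)"
    by (rule Lim_transform_eventually)
      (auto simp: eventually_at_filter norm_divide[symmetric] diff_divide_distrib)
  then show ?thesis
    unfolding has_field_derivative_iff l_def[symmetric]
    by (simp add: tendsto_norm_zero_iff Lim_null[symmetric])
qed

text \<open>Restriction to the complex line through \<open>x\<close> in the direction of \<open>h\<close> reduces these bounds
  to one variable. The constants depend on \<open>M\<close> and \<open>r\<close> alone, neither on \<open>f\<close> nor on the point;
  this uniformity is what allows the passage to limits below.\<close>

lemma
  assumes S: "complex_vector.subspace S" and f: "analytic_on_ball S f"
    and M: "\<And>x. x \<in> unit_ball S \<Longrightarrow> cmod (f x) \<le> M"
    and x: "x \<in> S" "norm x + r < 1" and r: "0 < r"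
    and D: "has_complex_derivative_at S f x D" and h: "h \<in> S"
  shows analytic_derivative_bound: "cmod (D h) \<le> M / r * norm h"
    and analytic_remainder_bound:
      "norm h \<le> r / 2 \<Longrightarrow> cmod (f (x + h) - f x - D h) \<le> 2 * M * (norm h / r)\<^sup>2"
proof -
  have *: "cmod (D h) \<le> M / r * norm h \<and>
    (norm h \<le> r / 2 \<longrightarrow> cmod (f (x + h) - f x - D h) \<le> 2 * M * (norm h / r)\<^sup>2)"
  proof (cases "h = 0")
    case True
    have "D (0 *\<^sub>C h) = 0 * D h"
      using D h unfolding has_complex_derivative_at_def dual_def by blast
    then show ?thesis using True by simp
  next
    case False
    define e where "e = complex_of_real (1 / norm h) *\<^sub>C h"
    have e: "e \<in> S" "norm e = 1"
      using h S False by (auto simp: e_def norm_scaleC norm_divide complex_vector.subspace_scale)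
    have he: "h = complex_of_real (norm h) *\<^sub>C e"
      using False by (simp add: e_def scaleC_scaleC scaleC_one)
    have De: "D h = norm h * D e"
      using D e by (subst he) (simp add: has_complex_derivative_at_def dual_def)
    define u where "u t = f (x + t *\<^sub>C e)" for t
    have small: "norm (x + t *\<^sub>C e) < 1" if "cmod t < 1 - norm x" for t
      using norm_triangle_ineq[of x "t *\<^sub>C e"] that e by (simp add: norm_scaleC)
    have ball: "x + t *\<^sub>C e \<in> unit_ball S" if "cmod t < 1 - norm x" for t
      using small[OF that] S e x
      by (simp add: unit_ball_def complex_vector.subspace_add complex_vector.subspace_scale)
    have hol: "u holomorphic_on ball 0 (1 - norm x)"
      unfolding holomorphic_on_def field_differentiable_def
    proof
      fix t :: complex assume t: "t \<in> ball 0 (1 - norm x)"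
      then obtain D' where "has_complex_derivative_at S f (x + t *\<^sub>C e) D'"
        using f ball[of t] by (auto simp: analytic_on_ball_iff)
      from has_field_derivative_along_line[OF S e x(1) small this] t
      show "\<exists>u'. (u has_field_derivative u') (at t within ball 0 (1 - norm x))"
        by (auto simp: u_def[abs_def] intro: has_field_derivative_at_within)
    qed
    have "deriv u 0 = D e"
      using has_field_derivative_along_line[OF S e x(1), of 0 f D] D r x
      by (intro DERIV_imp_deriv) (simp add: u_def[abs_def])
    moreover have "cmod (u t) \<le> M" if "cmod t = r" for t
      using M[OF ball[of t]] that x by (simp add: u_def)
    ultimately have "cmod (D e) \<le> M / r"
      "norm h \<le> r / 2 \<Longrightarrow> cmod (u (norm h) - u 0 - D e * norm h) \<le> 2 * M * (norm h / r)\<^sup>2"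
      using holomorphic_first_order_remainder(1)[OF hol r, of M]
        holomorphic_first_order_remainder(2)[OF hol r, of M "complex_of_real (norm h)"] x
      by auto
    then show ?thesis
      using he mult_right_mono[of "cmod (D e)" "M / r" "norm h"]
      by (auto simp: De norm_mult u_def mult_ac)
  qed
  show "cmod (D h) \<le> M / r * norm h" using * by blast
  show "norm h \<le> r / 2 \<Longrightarrow> cmod (f (x + h) - f x - D h) \<le> 2 * M * (norm h / r)\<^sup>2"
    using * by blast
qed

lemma analytic_lipschitz_bound:
  assumes S: "complex_vector.subspace S" and f: "analytic_on_ball S f"
    and M: "\<And>x. x \<in> unit_ball S \<Longrightarrow> cmod (f x) \<le> M"
    and x: "x \<in> S" "norm x + r < 1" and r: "0 < r"
    and x': "x' \<in> S" "norm (x' - x) \<le> r / 2"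
  shows "cmod (f x' - f x) \<le> 2 * M / r * norm (x' - x)"
proof -
  have xb: "x \<in> unit_ball S" using x r by (simp add: unit_ball_def)
  then obtain D where D: "has_complex_derivative_at S f x D"
    using f by (auto simp: analytic_on_ball_iff)
  define h where "h = x' - x"
  have h: "h \<in> S" "norm h \<le> r / 2"
    using S x x' by (auto simp: h_def complex_vector.subspace_diff)
  have M0: "M \<ge> 0" using M[OF xb] norm_ge_zero order_trans by blast
  note b = analytic_derivative_bound[OF S f M x r D h(1)]
    and c = analytic_remainder_bound[OF S f M x r D h]
  have "2 * M * (norm h / r)\<^sup>2 = (M * norm h / r) * (norm h / (r / 2))"
    by (simp add: power2_eq_square)
  also have "\<dots> \<le> (M * norm h / r) * 1"
    using h M0 r by (intro mult_left_mono) (auto simp: divide_le_eq)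
  finally have "cmod (f (x + h) - f x - D h) \<le> M * norm h / r" using c by simp
  moreover have "cmod (f (x + h) - f x) \<le> cmod (f (x + h) - f x - D h) + cmod (D h)"
    using norm_triangle_ineq[of "f (x + h) - f x - D h" "D h"] by simp
  ultimately have "cmod (f (x + h) - f x) \<le> 2 * M / r * norm h" using b by simp
  then show ?thesis by (simp add: h_def)
qed

section \<open>The dual space and the algebras\<close>

lemma dualD:
  assumes "\<phi> \<in> dual S"
  shows "x \<in> S \<Longrightarrow> y \<in> S \<Longrightarrow> \<phi> (x + y) = \<phi> x + \<phi> y"
    and "x \<in> S \<Longrightarrow> \<phi> (c *\<^sub>C x) = c * \<phi> x"
    and "x \<notin> S \<Longrightarrow> \<phi> x = 0"
  using assms by (auto simp: dual_def)

lemma dual_bounded: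
  assumes "\<phi> \<in> dual S"
  obtains K where "K \<ge> 0" "\<And>x. x \<in> S \<Longrightarrow> cmod (\<phi> x) \<le> K * norm x"
proof -
  obtain K where K: "\<And>x. x \<in> S \<Longrightarrow> cmod (\<phi> x) \<le> K * norm x"
    using assms unfolding dual_def by blast
  have "cmod (\<phi> x) \<le> \<bar>K\<bar> * norm x" if "x \<in> S" for x
    using K[OF that] abs_ge_self[of K] mult_right_mono[of K "\<bar>K\<bar>" "norm x"] by simp
  then show ?thesis using that[of "\<bar>K\<bar>"] by simp
qed

lemma dual_diff:
  assumes "\<phi> \<in> dual S" "complex_vector.subspace S" "x \<in> S" "y \<in> S"
  shows "\<phi> (x - y) = \<phi> x - \<phi> y"
proof -
  have "\<phi> (x - y + y) = \<phi> (x - y) + \<phi> y"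
    by (intro dualD(1)[OF assms(1)] complex_vector.subspace_diff assms)
  then show ?thesis by simp
qed

lemma dual_add:
  assumes "\<phi> \<in> dual S" "\<psi> \<in> dual S"
  shows "(\<lambda>x. \<phi> x + \<psi> x) \<in> dual S"
proof -
  obtain K where K: "\<And>x. x \<in> S \<Longrightarrow> cmod (\<phi> x) \<le> K * norm x"
    using dual_bounded[OF assms(1)] by blast
  obtain L where L: "\<And>x. x \<in> S \<Longrightarrow> cmod (\<psi> x) \<le> L * norm x"
    using dual_bounded[OF assms(2)] by blast
  have "cmod (\<phi> x + \<psi> x) \<le> (K + L) * norm x" if "x \<in> S" for x
    using norm_triangle_ineq[of "\<phi> x" "\<psi> x"] K[OF that] L[OF that]
    by (simp add: distrib_right)
  then have "\<exists>K. \<forall>x\<in>S. cmod (\<phi> x + \<psi> x) \<le> K * norm x" by blast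
  then show ?thesis using assms by (simp add: dual_def algebra_simps)
qed

lemma dual_mult:
  assumes "\<phi> \<in> dual S"
  shows "(\<lambda>x. c * \<phi> x) \<in> dual S"
proof -
  obtain K where K: "\<And>x. x \<in> S \<Longrightarrow> cmod (\<phi> x) \<le> K * norm x"
    using dual_bounded[OF assms] by blast
  have "cmod (c * \<phi> x) \<le> (cmod c * K) * norm x" if "x \<in> S" for x
    using mult_left_mono[OF K[OF that] norm_ge_zero[of c]] by (simp add: norm_mult mult.assoc)
  then have "\<exists>K. \<forall>x\<in>S. cmod (c * \<phi> x) \<le> K * norm x" by blast
  then show ?thesis using assms by (simp add: dual_def algebra_simps)
qed

lemma norm_le_dual_norm:
  assumes \<phi>: "\<phi> \<in> dual S" and v: "v \<in> S" "norm v \<le> 1"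
  shows "cmod (\<phi> v) \<le> dual_norm S \<phi>"
  unfolding dual_norm_def
proof (rule cSUP_upper)
  obtain K where K: "K \<ge> 0" "\<And>x. x \<in> S \<Longrightarrow> cmod (\<phi> x) \<le> K * norm x"
    using dual_bounded[OF \<phi>] by blast
  show "bdd_above ((\<lambda>x. cmod (\<phi> x)) ` {x\<in>S. norm x \<le> 1})"
  proof (rule bdd_aboveI2)
    fix x assume "x \<in> {x\<in>S. norm x \<le> 1}"
    then show "cmod (\<phi> x) \<le> K"
      using K(2)[of x] mult_left_mono[of "norm x" 1 K] K(1) by auto
  qed
qed (use v in auto)

lemma norm_le_dual_norm_mult:
  assumes S: "complex_vector.subspace S" and \<phi>: "\<phi> \<in> dual S" and x: "x \<in> S"
  shows "cmod (\<phi> x) \<le> dual_norm S \<phi> * norm x"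
proof (cases "x = 0")
  case True
  then show ?thesis using dualD(2)[OF \<phi> x, of 0] by simp
next
  case False
  define v where "v = complex_of_real (1 / norm x) *\<^sub>C x"
  have v: "v \<in> S" "norm v = 1"
    using x S False by (auto simp: v_def norm_scaleC norm_divide complex_vector.subspace_scale)
  have "cmod (\<phi> v) = cmod (\<phi> x) / norm x"
    using dualD(2)[OF \<phi> x] by (simp add: v_def norm_mult norm_divide)
  then show ?thesis
    using norm_le_dual_norm[OF \<phi>, of v] v False by (simp add: divide_le_eq)
qed

lemma dual_norm_nonneg:
  assumes "complex_vector.subspace S" "\<phi> \<in> dual S"
  shows "dual_norm S \<phi> \<ge> 0"
  using norm_le_dual_norm[OF assms(2), of 0] complex_vector.subspace_0[OF assms(1)]
    order_trans[OF norm_ge_zero] by simp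

lemma dual_norm_le:
  assumes "0 \<in> S" "K \<ge> 0" "\<And>x. x \<in> S \<Longrightarrow> cmod (\<phi> x) \<le> K * norm x"
  shows "dual_norm S \<phi> \<le> K"
  unfolding dual_norm_def
proof (rule cSUP_least)
  show "{x\<in>S. norm x \<le> 1} \<noteq> {}" using assms(1) by force
  fix x assume "x \<in> {x\<in>S. norm x \<le> 1}"
  then show "cmod (\<phi> x) \<le> K"
    using assms(3)[of x] mult_left_mono[of "norm x" 1 K] assms(2) by auto
qed

text \<open>For bounded functions this is equivalent to analyticity. Unlike the little-o form of the
  derivative, it is an inequality with constants that survives limits and the formation of sums
  and products. Stating it for all sufficiently small \<open>d\<close> instead of for some \<open>d\<close> lets the radii
  belonging to several functions be intersected by filter reasoning.\<close>

definition quadratic_remainder_on_ball ::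
    "'a :: complex_normed_vector set \<Rightarrow> ('a \<Rightarrow> complex) \<Rightarrow> bool" where
  "quadratic_remainder_on_ball S f \<longleftrightarrow>
     (\<forall>x\<in>unit_ball S. \<exists>D\<in>dual S. \<exists>C. \<forall>\<^sub>F d in at_right 0. \<forall>h\<in>S. norm h \<le> d \<longrightarrow>
        cmod (f (x + h) - f x - D h) \<le> C * (norm h)\<^sup>2)"

lemma quadratic_remainder_imp_analytic:
  assumes S: "complex_vector.subspace S" and f: "quadratic_remainder_on_ball S f"
  shows "analytic_on_ball S f"
  unfolding analytic_on_ball_def
proof
  fix x assume x: "x \<in> unit_ball S"
  then obtain D C where D: "D \<in> dual S" and
    "\<forall>\<^sub>F d in at_right 0. \<forall>h\<in>S. norm h \<le> d \<longrightarrow> cmod (f (x + h) - f x - D h) \<le> C * (norm h)\<^sup>2"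
    using f by (auto simp: quadratic_remainder_on_ball_def)
  then obtain b where b: "b > 0" "\<And>d h. 0 < d \<Longrightarrow> d < b \<Longrightarrow> h \<in> S \<Longrightarrow> norm h \<le> d \<Longrightarrow>
      cmod (f (x + h) - f x - D h) \<le> C * (norm h)\<^sup>2"
    unfolding eventually_at_right_field by blast
  define d where "d = b / 2"
  have d: "d > 0"
    "\<And>h. h \<in> S \<Longrightarrow> norm h \<le> d \<Longrightarrow> cmod (f (x + h) - f x - D h) \<le> C * (norm h)\<^sup>2"
    using b(1) b(2)[of d] by (auto simp: d_def)
  have "((\<lambda>y. (f y - f x - D (y - x)) /\<^sub>R norm (y - x)) \<longlongrightarrow> 0) (at x within unit_ball S)"
  proof (rule Lim_null_comparison)
    have "((\<lambda>y. C * norm (y - x)) \<longlongrightarrow> C * norm (x - x)) (at x within unit_ball S)"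
      by (intro tendsto_intros)
    then show "((\<lambda>y. C * norm (y - x)) \<longlongrightarrow> 0) (at x within unit_ball S)" by simp
    have "\<forall>\<^sub>F y in at x within unit_ball S. dist y x < d"
      using d(1) by (auto simp: eventually_at)
    moreover have "\<forall>\<^sub>F y in at x within unit_ball S. y \<in> unit_ball S \<and> y \<noteq> x"
      by (auto simp: eventually_at_filter)
    ultimately show "\<forall>\<^sub>F y in at x within unit_ball S.
        norm ((f y - f x - D (y - x)) /\<^sub>R norm (y - x)) \<le> C * norm (y - x)"
    proof eventually_elim
      case (elim y)
      then have "cmod (f (x + (y - x)) - f x - D (y - x)) \<le> C * (norm (y - x))\<^sup>2"
        using x by (intro d(2)) (auto simp: unit_ball_def dist_norm complex_vector.subspace_diff[OF S])
      then have "cmod (f y - f x - D (y - x)) \<le> C * norm (y - x) * norm (y - x)"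
        by (simp add: power2_eq_square mult.assoc)
      then have "cmod (f y - f x - D (y - x)) / norm (y - x) \<le> C * norm (y - x)"
        using elim by (simp add: divide_le_eq)
      then show ?case by (simp only: norm_scaleR divide_inverse) (simp add: mult.commute)
    qed
  qed
  then show "\<exists>D\<in>dual S. ((\<lambda>y. (f y - f x - D (y - x)) /\<^sub>R norm (y - x)) \<longlongrightarrow> 0)
      (at x within unit_ball S)"
    using D by blast
qed

lemma H_infinity_bounded:
  assumes "f \<in> H_infinity S"
  obtains M where "M \<ge> 0" "\<And>x. cmod (f x) \<le> M"
proof -
  obtain M where M: "\<And>x. x \<in> unit_ball S \<Longrightarrow> cmod (f x) \<le> M"
    using assms by (auto simp: H_infinity_def bounded_iff)
  have "cmod (f x) \<le> \<bar>M\<bar>" for x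
    using M[of x] assms by (cases "x \<in> unit_ball S") (auto simp: H_infinity_def)
  then show ?thesis using that[of "\<bar>M\<bar>"] by simp
qed

lemma H_infinity_imp_quadratic_remainder:
  assumes S: "complex_vector.subspace S" and f: "f \<in> H_infinity S"
  shows "quadratic_remainder_on_ball S f"
  unfolding quadratic_remainder_on_ball_def
proof
  fix x assume x: "x \<in> unit_ball S"
  obtain M where M: "\<And>x. cmod (f x) \<le> M" using H_infinity_bounded[OF f] by blast
  have an: "analytic_on_ball S f" using f by (simp add: H_infinity_def)
  then obtain D where D: "has_complex_derivative_at S f x D"
    using x by (auto simp: analytic_on_ball_iff)
  define r where "r = (1 - norm x) / 2"
  have r: "r > 0" "norm x + r < 1" using x by (auto simp: r_def unit_ball_def field_simps)
  have "cmod (f (x + h) - f x - D h) \<le> 2 * M / r\<^sup>2 * (norm h)\<^sup>2" if "h \<in> S" "norm h \<le> r / 2" for h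
    using analytic_remainder_bound[OF S an M _ r(2,1) D that] x
    by (simp add: unit_ball_def power_divide)
  moreover have "\<forall>\<^sub>F d in at_right 0. d \<le> r / 2"
    using eventually_at_right_real[of 0 "r / 2"] r by (auto elim: eventually_mono)
  ultimately have "\<forall>\<^sub>F d in at_right 0. \<forall>h\<in>S. norm h \<le> d \<longrightarrow>
      cmod (f (x + h) - f x - D h) \<le> 2 * M / r\<^sup>2 * (norm h)\<^sup>2"
    by (auto elim!: eventually_mono)
  then show "\<exists>D\<in>dual S. \<exists>C. \<forall>\<^sub>F d in at_right 0. \<forall>h\<in>S. norm h \<le> d \<longrightarrow>
      cmod (f (x + h) - f x - D h) \<le> C * (norm h)\<^sup>2"
    using D unfolding has_complex_derivative_at_def by blast
qed

lemma functions_of_iff: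
  assumes S: "complex_vector.subspace S"
  shows "f \<in> functions_of H S \<longleftrightarrow>
    quadratic_remainder_on_ball S f \<and> bounded (f ` unit_ball S) \<and> (\<forall>x. x \<notin> unit_ball S \<longrightarrow> f x = 0) \<and>
    (H = Uniform_Algebra \<longrightarrow> uniformly_continuous_on (unit_ball S) f)"
  using quadratic_remainder_imp_analytic[OF S, of f] H_infinity_imp_quadratic_remainder[OF S, of f]
  by (cases H) (auto simp: A_u_def H_infinity_def)

lemma functions_of_H_infinity: "f \<in> functions_of H S \<Longrightarrow> f \<in> H_infinity S"
  by (cases H) (auto simp: A_u_def)

lemma functions_of_add:
  assumes S: "complex_vector.subspace S" and f: "f \<in> functions_of H S" and g: "g \<in> functions_of H S"
  shows "(\<lambda>x. f x + g x) \<in> functions_of H S"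
proof -
  have "quadratic_remainder_on_ball S (\<lambda>x. f x + g x)"
    unfolding quadratic_remainder_on_ball_def
  proof
    fix x assume x: "x \<in> unit_ball S"
    obtain D C where D: "D \<in> dual S" and 1: "\<forall>\<^sub>F d in at_right 0. \<forall>h\<in>S. norm h \<le> d \<longrightarrow>
        cmod (f (x + h) - f x - D h) \<le> C * (norm h)\<^sup>2"
      using f x by (auto simp: functions_of_iff[OF S] quadratic_remainder_on_ball_def)
    obtain E B where E: "E \<in> dual S" and 2: "\<forall>\<^sub>F d in at_right 0. \<forall>h\<in>S. norm h \<le> d \<longrightarrow>
        cmod (g (x + h) - g x - E h) \<le> B * (norm h)\<^sup>2"
      using g x by (auto simp: functions_of_iff[OF S] quadratic_remainder_on_ball_def)
    have "\<forall>\<^sub>F d in at_right 0. \<forall>h\<in>S. norm h \<le> d \<longrightarrow>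
        cmod (f (x + h) + g (x + h) - (f x + g x) - (D h + E h)) \<le> (C + B) * (norm h)\<^sup>2"
      using 1 2
    proof eventually_elim
      case (elim d)
      show ?case
      proof (intro ballI impI)
        fix h assume h: "h \<in> S" "norm h \<le> d"
        have eq: "f (x + h) + g (x + h) - (f x + g x) - (D h + E h)
            = (f (x + h) - f x - D h) + (g (x + h) - g x - E h)" by simp
        show "cmod (f (x + h) + g (x + h) - (f x + g x) - (D h + E h)) \<le> (C + B) * (norm h)\<^sup>2"
          using norm_triangle_mono[of "f (x + h) - f x - D h" "C * (norm h)\<^sup>2"
              "g (x + h) - g x - E h" "B * (norm h)\<^sup>2"] elim h
          unfolding eq by (simp add: distrib_right)
      qed
    qed
    then show "\<exists>D\<in>dual S. \<exists>C. \<forall>\<^sub>F d in at_right 0. \<forall>h\<in>S. norm h \<le> d \<longrightarrow>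
        cmod (f (x + h) + g (x + h) - (f x + g x) - D h) \<le> C * (norm h)\<^sup>2"
      using dual_add[OF D E] by (intro bexI[of _ "\<lambda>h. D h + E h"]) auto
  qed
  moreover have "bounded ((\<lambda>x. f x + g x) ` unit_ball S)"
    using f g by (intro bounded_plus_comp) (auto simp: functions_of_iff[OF S])
  moreover have "uniformly_continuous_on (unit_ball S) (\<lambda>x. f x + g x)" if "H = Uniform_Algebra"
    using f g that unfolding functions_of_iff[OF S] by (auto intro: uniformly_continuous_on_add)
  ultimately show ?thesis using f g by (simp add: functions_of_iff[OF S])
qed

lemma uniformly_continuous_on_mult_bounded:
  fixes f g :: "'a :: metric_space \<Rightarrow> complex"
  assumes f: "uniformly_continuous_on A f" "bounded (f ` A)"
    and g: "uniformly_continuous_on A g" "bounded (g ` A)"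
  shows "uniformly_continuous_on A (\<lambda>x. f x * g x)"
  unfolding uniformly_continuous_on_def
proof (intro allI impI)
  fix e :: real assume e: "e > 0"
  obtain M where M: "M > 0" "\<And>x. x \<in> A \<Longrightarrow> cmod (f x) \<le> M" using f(2) by (auto simp: bounded_pos)
  obtain N where N: "N > 0" "\<And>x. x \<in> A \<Longrightarrow> cmod (g x) \<le> N" using g(2) by (auto simp: bounded_pos)
  have eN: "e / (2 * N) > 0" and eM: "e / (2 * M) > 0" using e M N by auto
  obtain d where d: "d > 0" "\<forall>x\<in>A. \<forall>y\<in>A. dist y x < d \<longrightarrow> dist (f y) (f x) < e / (2 * N)"
    using f(1) eN unfolding uniformly_continuous_on_def by blast
  obtain d' where d': "d' > 0"
    "\<forall>x\<in>A. \<forall>y\<in>A. dist y x < d' \<longrightarrow> dist (g y) (g x) < e / (2 * M)"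
    using g(1) eM unfolding uniformly_continuous_on_def by blast
  have "dist (f y * g y) (f x * g x) < e" if "x \<in> A" "y \<in> A" "dist y x < min d d'" for x y
  proof -
    have "f y * g y - f x * g x = (f y - f x) * g y + f x * (g y - g x)"
      by (simp add: algebra_simps)
    then have "cmod (f y * g y - f x * g x) \<le> cmod (f y - f x) * cmod (g y) + cmod (f x) * cmod (g y - g x)"
      using norm_triangle_ineq[of "(f y - f x) * g y" "f x * (g y - g x)"]
      by (simp only: norm_mult)
    also have "\<dots> \<le> cmod (f y - f x) * N + M * cmod (g y - g x)"
      using M N that by (intro add_mono mult_mono) auto
    also have "\<dots> < e / (2 * N) * N + M * (e / (2 * M))"
      using d(2) d'(2) that M N
      by (intro add_strict_mono mult_strict_right_mono mult_strict_left_mono) (auto simp: dist_norm)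
    also have "\<dots> = e" using M N by simp
    finally show ?thesis by (simp add: dist_norm)
  qed
  then show "\<exists>d>0. \<forall>x\<in>A. \<forall>x'\<in>A. dist x' x < d \<longrightarrow> dist (f x' * g x') (f x * g x) < e"
    using d(1) d'(1) by (intro exI[of _ "min d d'"]) auto
qed

text \<open>The product rule; the remainder of \<open>f g\<close> splits as \<open>F g(x + h) + f(x) G + D h (G + E h)\<close>,
  where \<open>F, G\<close> are the remainders and \<open>D, E\<close> the derivatives of the factors.\<close>

lemma functions_of_mult:
  assumes S: "complex_vector.subspace S" and f: "f \<in> functions_of H S" and g: "g \<in> functions_of H S"
  shows "(\<lambda>x. f x * g x) \<in> functions_of H S"
proof -
  obtain M where M: "M \<ge> 0" "\<And>x. cmod (f x) \<le> M"
    using H_infinity_bounded[OF functions_of_H_infinity[OF f]] by blast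
  obtain N where N: "N \<ge> 0" "\<And>x. cmod (g x) \<le> N"
    using H_infinity_bounded[OF functions_of_H_infinity[OF g]] by blast
  have "quadratic_remainder_on_ball S (\<lambda>x. f x * g x)"
    unfolding quadratic_remainder_on_ball_def
  proof
    fix x assume x: "x \<in> unit_ball S"
    obtain D C where D: "D \<in> dual S" and 1: "\<forall>\<^sub>F d in at_right 0. \<forall>h\<in>S. norm h \<le> d \<longrightarrow>
        cmod (f (x + h) - f x - D h) \<le> C * (norm h)\<^sup>2"
      using f x by (auto simp: functions_of_iff[OF S] quadratic_remainder_on_ball_def)
    obtain E B where E: "E \<in> dual S" and 2: "\<forall>\<^sub>F d in at_right 0. \<forall>h\<in>S. norm h \<le> d \<longrightarrow>
        cmod (g (x + h) - g x - E h) \<le> B * (norm h)\<^sup>2"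
      using g x by (auto simp: functions_of_iff[OF S] quadratic_remainder_on_ball_def)
    obtain K where K: "K \<ge> 0" "\<And>x. x \<in> S \<Longrightarrow> cmod (D x) \<le> K * norm x" using dual_bounded[OF D] by blast
    obtain L where L: "L \<ge> 0" "\<And>x. x \<in> S \<Longrightarrow> cmod (E x) \<le> L * norm x" using dual_bounded[OF E] by blast
    have "\<forall>\<^sub>F d in at_right (0 :: real). d \<le> 1"
      using eventually_at_right_real[of 0 "1 :: real"] by (auto elim: eventually_mono)
    then have "\<forall>\<^sub>F d in at_right 0. \<forall>h\<in>S. norm h \<le> d \<longrightarrow>
        cmod (f (x + h) * g (x + h) - f x * g x - (g x * D h + f x * E h))
          \<le> (C * N + M * B + K * (\<bar>B\<bar> + L)) * (norm h)\<^sup>2"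
      using 1 2
    proof eventually_elim
      case (elim d)
      show ?case
      proof (intro ballI impI)
        fix h assume h: "h \<in> S" "norm h \<le> d"
        let ?F = "f (x + h) - f x - D h" and ?G = "g (x + h) - g x - E h"
        have FG: "cmod ?F \<le> C * (norm h)\<^sup>2" "cmod ?G \<le> B * (norm h)\<^sup>2" using elim h by auto
        have "(norm h)\<^sup>2 \<le> norm h" using elim h by (simp add: power2_eq_square mult_left_le)
        then have "B * (norm h)\<^sup>2 \<le> \<bar>B\<bar> * norm h" by (intro mult_mono) auto
        then have "cmod ?G \<le> \<bar>B\<bar> * norm h" using FG(2) by linarith
        then have gh: "cmod (?G + E h) \<le> (\<bar>B\<bar> + L) * norm h"
          using L(2)[OF h(1)] norm_triangle_ineq[of ?G "E h"] by (simp add: distrib_right)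
        have "f (x + h) * g (x + h) - f x * g x - (g x * D h + f x * E h)
            = ?F * g (x + h) + f x * ?G + D h * (?G + E h)"
          by (simp add: algebra_simps)
        then have "cmod (f (x + h) * g (x + h) - f x * g x - (g x * D h + f x * E h))
            \<le> cmod ?F * cmod (g (x + h)) + cmod (f x) * cmod ?G + cmod (D h) * cmod (?G + E h)"
          using norm_triangle_ineq[of "?F * g (x + h) + f x * ?G" "D h * (?G + E h)"]
            norm_triangle_ineq[of "?F * g (x + h)" "f x * ?G"]
          by (simp only: norm_mult)
        also have "\<dots> \<le> C * (norm h)\<^sup>2 * N + M * (B * (norm h)\<^sup>2) + K * norm h * ((\<bar>B\<bar> + L) * norm h)"
          using FG gh M N K(2)[OF h(1)] K(1) order_trans[OF norm_ge_zero FG(1)]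
          by (intro add_mono mult_mono) auto
        also have "\<dots> = (C * N + M * B + K * (\<bar>B\<bar> + L)) * (norm h)\<^sup>2"
          by (simp add: algebra_simps power2_eq_square)
        finally show "cmod (f (x + h) * g (x + h) - f x * g x - (g x * D h + f x * E h))
          \<le> (C * N + M * B + K * (\<bar>B\<bar> + L)) * (norm h)\<^sup>2" .
      qed
    qed
    then show "\<exists>D\<in>dual S. \<exists>C. \<forall>\<^sub>F d in at_right 0. \<forall>h\<in>S. norm h \<le> d \<longrightarrow>
        cmod (f (x + h) * g (x + h) - f x * g x - D h) \<le> C * (norm h)\<^sup>2"
      using dual_add[OF dual_mult[OF D, of "g x"] dual_mult[OF E, of "f x"]]
      by (intro bexI[of _ "\<lambda>h. g x * D h + f x * E h"]) auto
  qed
  moreover have "bounded ((\<lambda>x. f x * g x) ` unit_ball S)"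
    using mult_mono[OF M(2) N(2) M(1)] by (auto simp: bounded_iff norm_mult)
  ultimately show ?thesis
    using f g by (simp add: functions_of_iff[OF S] uniformly_continuous_on_mult_bounded)
qed

lemma functions_of_scale:
  assumes S: "complex_vector.subspace S" and f: "f \<in> functions_of H S"
  shows "(\<lambda>x. c * f x) \<in> functions_of H S"
proof -
  have "quadratic_remainder_on_ball S (\<lambda>x. c * f x)"
    unfolding quadratic_remainder_on_ball_def
  proof
    fix x assume x: "x \<in> unit_ball S"
    obtain D C where D: "D \<in> dual S" and 1: "\<forall>\<^sub>F d in at_right 0. \<forall>h\<in>S. norm h \<le> d \<longrightarrow>
        cmod (f (x + h) - f x - D h) \<le> C * (norm h)\<^sup>2"
      using f x by (auto simp: functions_of_iff[OF S] quadratic_remainder_on_ball_def)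
    have *: "cmod (c * u - c * v - c * w) = cmod c * cmod (u - v - w)" for u v w
      by (simp add: norm_mult[symmetric] right_diff_distrib)
    from 1 have "\<forall>\<^sub>F d in at_right 0. \<forall>h\<in>S. norm h \<le> d \<longrightarrow>
        cmod (c * f (x + h) - c * f x - c * D h) \<le> cmod c * C * (norm h)\<^sup>2"
      by eventually_elim (auto simp: * mult.assoc intro!: mult_left_mono)
    then show "\<exists>D\<in>dual S. \<exists>C. \<forall>\<^sub>F d in at_right 0. \<forall>h\<in>S. norm h \<le> d \<longrightarrow>
        cmod (c * f (x + h) - c * f x - D h) \<le> C * (norm h)\<^sup>2"
      using dual_mult[OF D, of c] by (intro bexI[of _ "\<lambda>h. c * D h"]) auto
  qed
  moreover obtain M where M: "M \<ge> 0" "\<And>x. cmod (f x) \<le> M"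
    using H_infinity_bounded[OF functions_of_H_infinity[OF f]] by blast
  have "bounded ((\<lambda>x. c * f x) ` unit_ball S)"
    using mult_left_mono[OF M(2) norm_ge_zero[of c]] by (auto simp: bounded_iff norm_mult)
  moreover have "uniformly_continuous_on (unit_ball S) (\<lambda>x. c * f x)" if "H = Uniform_Algebra"
    using f that unfolding functions_of_iff[OF S]
    by (intro uniformly_continuous_on_mult_bounded uniformly_continuous_on_const)
      (auto simp: bounded_iff)
  ultimately show ?thesis using f by (simp add: functions_of_iff[OF S])
qed

lemma dual_in_functions_of:
  assumes S: "complex_vector.subspace S" and \<phi>: "\<phi> \<in> dual S"
  shows "restrict0 (unit_ball S) \<phi> \<in> functions_of H S"
proof -
  obtain K where K: "K \<ge> 0" "\<And>x. x \<in> S \<Longrightarrow> cmod (\<phi> x) \<le> K * norm x"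
    using dual_bounded[OF \<phi>] by blast
  have "quadratic_remainder_on_ball S (restrict0 (unit_ball S) \<phi>)"
    unfolding quadratic_remainder_on_ball_def
  proof
    fix x assume x: "x \<in> unit_ball S"
    have "\<forall>\<^sub>F d in at_right 0. d < 1 - norm x"
      using x eventually_at_right_real[of 0 "1 - norm x"]
      by (auto simp: unit_ball_def elim: eventually_mono)
    then have "\<forall>\<^sub>F d in at_right 0. \<forall>h\<in>S. norm h \<le> d \<longrightarrow>
        cmod (restrict0 (unit_ball S) \<phi> (x + h) - restrict0 (unit_ball S) \<phi> x - \<phi> h) \<le> 0 * (norm h)\<^sup>2"
    proof eventually_elim
      case (elim d)
      have "x + h \<in> unit_ball S \<and> \<phi> (x + h) = \<phi> x + \<phi> h" if "h \<in> S" "norm h \<le> d" for h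
        using norm_triangle_ineq[of x h] that x elim dualD(1)[OF \<phi>, of x h]
        by (auto simp: unit_ball_def complex_vector.subspace_add[OF S])
      then show ?case using x by (auto simp: restrict0_def)
    qed
    then show "\<exists>D\<in>dual S. \<exists>C. \<forall>\<^sub>F d in at_right 0. \<forall>h\<in>S. norm h \<le> d \<longrightarrow>
        cmod (restrict0 (unit_ball S) \<phi> (x + h) - restrict0 (unit_ball S) \<phi> x - D h) \<le> C * (norm h)\<^sup>2"
      using \<phi> by blast
  qed
  moreover have "cmod (restrict0 (unit_ball S) \<phi> x) \<le> K" for x
    using K(2)[of x] K(1) mult_left_mono[of "norm x" 1 K] by (auto simp: restrict0_def unit_ball_def)
  then have "bounded (restrict0 (unit_ball S) \<phi> ` unit_ball S)" by (auto simp: bounded_iff)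
  moreover have "uniformly_continuous_on (unit_ball S) (restrict0 (unit_ball S) \<phi>)"
    unfolding uniformly_continuous_on_def
  \<comment> \<open>\<open>K + 1\<close> instead of the Lipschitz constant \<open>K\<close>, which may be 0.\<close>
  proof (intro allI impI exI[of _ "e / (K + 1)" for e] conjI ballI)
    fix e :: real assume e: "e > 0"
    show "e / (K + 1) > 0" using e K by simp
    fix x y assume xy: "x \<in> unit_ball S" "y \<in> unit_ball S" "dist y x < e / (K + 1)"
    have "cmod (\<phi> y - \<phi> x) = cmod (\<phi> (y - x))"
      using xy by (simp add: dual_diff[OF \<phi> S] unit_ball_def)
    also have "\<dots> \<le> K * norm (y - x)"
      using xy by (intro K(2)) (auto simp: unit_ball_def complex_vector.subspace_diff[OF S])
    also have "\<dots> \<le> (K + 1) * norm (y - x)" by (intro mult_right_mono) auto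
    also have "\<dots> < e" using xy(3) K(1) by (simp add: dist_norm field_simps)
    finally show "dist (restrict0 (unit_ball S) \<phi> y) (restrict0 (unit_ball S) \<phi> x) < e"
      using xy by (simp add: restrict0_def dist_norm)
  qed
  ultimately show ?thesis by (simp add: functions_of_iff[OF S] restrict0_def)
qed

section \<open>Coordinates and total of a sequence in an l1 sum\<close>

lift_definition l1_single :: "nat \<Rightarrow> 'a :: real_normed_vector \<Rightarrow> 'a l1seq"
  is "\<lambda>n v k. if k = n then v else 0"
  by (rule summable_finite[of "{n}" for n]) auto

lemma l1_single_add: "l1_single n (v + w) = l1_single n v + l1_single n w"
  by transfer auto

lemma l1_single_diff: "l1_single n (v - w) = l1_single n v - l1_single n w"
  by transfer auto

lemma l1_single_scaleC: "l1_single n (c *\<^sub>C v) = c *\<^sub>C l1_single n v"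
  by transfer auto

lemma norm_l1_single: "norm (l1_single n v) = norm v"
proof transfer
  fix n and v :: 'a
  have "(\<Sum>k. norm (if k = n then v else 0)) = (\<Sum>k\<in>{n}. norm (if k = n then v else 0))"
    by (rule suminf_finite) auto
  then show "(\<Sum>k. norm (if k = n then v else 0)) = norm v" by simp
qed

definition l1_total :: "'a :: banach l1seq \<Rightarrow> 'a" where
  "l1_total z = (\<Sum>n. l1_nth z n)"

lemma summable_l1: "summable (l1_nth z)" for z :: "'a :: banach l1seq"
  by (rule summable_norm_cancel[OF summable_l1_nth])

lemma l1_total_add: "l1_total (z + w) = l1_total z + l1_total w"
  by (simp add: l1_total_def plus_l1seq.rep_eq suminf_add summable_l1)

lemma l1_total_diff: "l1_total (z - w) = l1_total z - l1_total w"
  by (simp add: l1_total_def minus_l1seq.rep_eq suminf_diff summable_l1)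

lemma bounded_linear_scaleC: "bounded_linear (\<lambda>x :: 'a :: complex_normed_vector. c *\<^sub>C x)"
proof (rule bounded_linear_intro)
  fix x y :: 'a and r :: real
  show "c *\<^sub>C (x + y) = c *\<^sub>C x + c *\<^sub>C y" by (rule scaleC_add_right)
  show "c *\<^sub>C (r *\<^sub>R x) = r *\<^sub>R (c *\<^sub>C x)"
    by (simp add: scaleC_of_real[symmetric] scaleC_scaleC mult.commute)
  show "norm (c *\<^sub>C x) \<le> norm x * cmod c" by (simp add: norm_scaleC mult.commute)
qed

lemma l1_total_scaleC: "l1_total (c *\<^sub>C z) = c *\<^sub>C l1_total z" for z :: "'a :: cbanach l1seq"
  using bounded_linear.suminf[OF bounded_linear_scaleC summable_l1, of c z]
  by (simp add: l1_total_def scaleC_l1seq.rep_eq)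

lemma norm_l1_total_le: "norm (l1_total z) \<le> norm z"
  unfolding l1_total_def norm_l1seq.rep_eq by (rule summable_norm[OF summable_l1_nth])

lemma l1_total_single: "l1_total (l1_single n v) = v"
proof -
  have "(\<Sum>k. l1_nth (l1_single n v) k) = (\<Sum>k\<in>{n}. l1_nth (l1_single n v) k)"
    by (rule suminf_finite) (auto simp: l1_single.rep_eq)
  then show ?thesis by (simp add: l1_total_def l1_single.rep_eq)
qed

section \<open>Limits along the coordinate inclusions\<close>

text \<open>In the formulas below, \<open>U\<close> is the filter along which all limits are taken.\<close>

locale dense_exhaustion =
  fixes Y :: "nat \<Rightarrow> 'a :: cbanach set" and U :: "nat filter"
  assumes subspace_Y: "complex_vector.subspace (Y n)"
    and increasing_Y: "Y n \<subseteq> Y (Suc n)"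
    and dense_Y: "closure (\<Union>n. Y n) = UNIV"
    and U_nontrivial: "U \<noteq> bot"
    and U_le_sequentially: "U \<le> sequentially"
    and U_bounded_convergent: "bounded (range (s :: nat \<Rightarrow> complex)) \<Longrightarrow> \<exists>l. (s \<longlongrightarrow> l) U"
begin

abbreviation X :: "'a l1seq set" where "X \<equiv> l1_sum Y"

lemma subspace_X: "complex_vector.subspace X"
  by (intro subspace_l1_sum subspace_Y)

lemma l1_single_in: "v \<in> Y n \<Longrightarrow> l1_single n v \<in> X"
  by (auto simp: l1_sum_def l1_single.rep_eq complex_vector.subspace_0[OF subspace_Y])

text \<open>The inclusion of the \<open>n\<close>-th summand accepts points of \<open>Y n\<close> only, so a point of \<open>'a\<close> reaches
  \<open>X\<close> through such a sequence. Approximations can be added and scaled, whereas the chosen one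
  below need not depend linearly on the point.\<close>

definition approximates :: "(nat \<Rightarrow> 'a) \<Rightarrow> 'a \<Rightarrow> bool" where
  "approximates a y \<longleftrightarrow> (\<forall>n. a n \<in> Y n) \<and> (a \<longlongrightarrow> y) U"

lemma approximates_add: "approximates a x \<Longrightarrow> approximates b y \<Longrightarrow> approximates (\<lambda>n. a n + b n) (x + y)"
  by (auto simp: approximates_def intro: tendsto_add complex_vector.subspace_add[OF subspace_Y])

lemma approximates_scaleC: "approximates a x \<Longrightarrow> approximates (\<lambda>n. c *\<^sub>C a n) (c *\<^sub>C x)"
  by (auto simp: approximates_def intro: bounded_linear.tendsto[OF bounded_linear_scaleC]
      complex_vector.subspace_scale[OF subspace_Y])

lemma approximates_diff_null:
  "approximates a y \<Longrightarrow> approximates b y \<Longrightarrow> ((\<lambda>n. norm (a n - b n)) \<longlongrightarrow> 0) U"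
  using tendsto_norm[OF tendsto_diff, of a y U b y] by (simp add: approximates_def)

lemma eventually_norm_less:
  "approximates a y \<Longrightarrow> norm y < r \<Longrightarrow> \<forall>\<^sub>F n in U. norm (a n) < r"
  by (auto simp: approximates_def intro: order_tendstoD(2)[OF tendsto_norm])

text \<open>Take \<open>a n\<close> nearly realizing the distance from \<open>y\<close> to \<open>Y n\<close>, which tends to 0.\<close>

lemma ex_approximates: "\<exists>a. approximates a y"
proof -
  have "\<exists>v\<in>Y n. dist v y < infdist y (Y n) + 1 / real (Suc n)" for n
  proof -
    have ne: "Y n \<noteq> {}" using complex_vector.subspace_0[OF subspace_Y] by blast
    have "bdd_below (dist y ` Y n)" by (rule bdd_belowI2[of _ 0]) auto
    moreover have "(INF v\<in>Y n. dist y v) < infdist y (Y n) + 1 / real (Suc n)"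
      using ne by (simp add: infdist_def)
    ultimately show ?thesis using ne by (auto simp: cINF_less_iff dist_commute)
  qed
  then obtain a where a: "\<And>n. a n \<in> Y n" "\<And>n. dist (a n) y < infdist y (Y n) + 1 / real (Suc n)"
    by metis
  have mono: "Y m \<subseteq> Y n" if "m \<le> n" for m n
    using that by (rule lift_Suc_mono_le[of Y, OF increasing_Y])
  have "(\<lambda>n. infdist y (Y n)) \<longlonglongrightarrow> 0"
  proof (rule LIMSEQ_I)
    fix e :: real assume e: "e > 0"
    then obtain v m where v: "v \<in> Y m" "dist v y < e"
      using dense_Y closure_approachable[of y "\<Union>n. Y n"] by auto
    have "infdist y (Y n) < e" if "n \<ge> m" for n
      using infdist_le[of v "Y n" y] v mono[OF that] by (auto simp: dist_commute)
    then show "\<exists>m. \<forall>n\<ge>m. norm (infdist y (Y n) - 0) < e"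
      by (auto simp: infdist_nonneg)
  qed
  moreover have "(\<lambda>n. 1 / real (Suc n)) \<longlonglongrightarrow> 0"
    by (rule LIMSEQ_Suc[OF lim_1_over_n])
  ultimately have "(\<lambda>n. infdist y (Y n) + 1 / real (Suc n)) \<longlonglongrightarrow> 0"
    using tendsto_add by fastforce
  then have "(\<lambda>n. dist (a n) y) \<longlonglongrightarrow> 0"
    by (rule Lim_null_comparison[rotated])
      (simp add: less_imp_le[OF a(2)] del: of_nat_Suc)
  then have "(a \<longlongrightarrow> y) sequentially" by (simp add: tendsto_dist_iff[of a])
  then show ?thesis using a(1) tendsto_mono[OF U_le_sequentially] by (auto simp: approximates_def)
qed

definition approx :: "'a \<Rightarrow> nat \<Rightarrow> 'a" where
  "approx y = (SOME a. approximates a y)"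

lemma approximates_approx: "approximates (approx y) y"
  unfolding approx_def by (rule someI_ex[OF ex_approximates])

lemma approximates_in: "approximates a y \<Longrightarrow> l1_single n (a n) \<in> X"
  by (simp add: approximates_def l1_single_in)

lemma tendsto_Lim_U:
  assumes "\<forall>\<^sub>F n in U. cmod (s n) \<le> K"
  shows "(s \<longlongrightarrow> Lim U s) U"
proof -
  \<comment> \<open>A sequence bounded along \<open>U\<close> only need not be bounded; truncation makes it so without
    changing its limit.\<close>
  define t where "t n = (if cmod (s n) \<le> K then s n else 0)" for n
  have "cmod (t n) \<le> \<bar>K\<bar>" for n by (auto simp: t_def)
  then have "bounded (range t)" by (auto simp: bounded_iff)
  then obtain l where "(t \<longlongrightarrow> l) U" using U_bounded_convergent by blast
  moreover have "\<forall>\<^sub>F n in U. t n = s n" using assms by eventually_elim (simp add: t_def)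
  ultimately have "(s \<longlongrightarrow> l) U" by (rule Lim_transform_eventually)
  then show ?thesis using tendsto_Lim[OF U_nontrivial] by metis
qed

text \<open>The functionals may vary with \<open>n\<close>: besides a constant sequence, which transports the dual of
  \<open>X\<close> to the dual of \<open>'a\<close>, the derivatives of a function at the points that approximate a given
  point are needed.\<close>

definition dual_limit :: "(nat \<Rightarrow> 'a l1seq \<Rightarrow> complex) \<Rightarrow> 'a \<Rightarrow> complex" where
  "dual_limit \<phi> h = Lim U (\<lambda>n. \<phi> n (l1_single n (approx h n)))"

text \<open>The common bound \<open>K\<close> gives existence of the limits, and shows that two approximations
  \<open>a, b\<close> of \<open>h\<close> give the same limit, since the values differ by at most \<open>K \<parallel>a n - b n\<parallel>\<close>.
  Linearity follows by adding approximations.\<close>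

lemma
  assumes \<phi>: "\<forall>\<^sub>F n in U. \<phi> n \<in> dual X" and K: "K \<ge> 0"
    and bd: "\<forall>\<^sub>F n in U. \<forall>x\<in>X. cmod (\<phi> n x) \<le> K * norm x"
  shows tendsto_dual_limit:
      "approximates a h \<Longrightarrow> ((\<lambda>n. \<phi> n (l1_single n (a n))) \<longlongrightarrow> dual_limit \<phi> h) U"
    and norm_dual_limit: "cmod (dual_limit \<phi> h) \<le> K * norm h"
    and dual_limit_in_dual: "dual_limit \<phi> \<in> dual UNIV"
proof -
  have lim: "((\<lambda>n. \<phi> n (l1_single n (a n))) \<longlongrightarrow> dual_limit \<phi> h) U" if a: "approximates a h" for a h
  proof -
    let ?b = "approx h"
    have "\<forall>\<^sub>F n in U. norm (?b n) < norm h + 1"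
      by (rule eventually_norm_less[OF approximates_approx]) simp
    with bd have "\<forall>\<^sub>F n in U. cmod (\<phi> n (l1_single n (?b n))) \<le> K * (norm h + 1)"
    proof eventually_elim
      case (elim n)
      then have "cmod (\<phi> n (l1_single n (?b n))) \<le> K * norm (?b n)"
        using approximates_in[OF approximates_approx] by (metis norm_l1_single)
      also have "\<dots> \<le> K * (norm h + 1)" using elim K by (intro mult_left_mono) auto
      finally show ?case .
    qed
    then have b: "((\<lambda>n. \<phi> n (l1_single n (?b n))) \<longlongrightarrow> dual_limit \<phi> h) U"
      unfolding dual_limit_def by (rule tendsto_Lim_U)
    have "((\<lambda>n. K * norm (a n - ?b n)) \<longlongrightarrow> K * 0) U"
      by (intro tendsto_mult_left approximates_diff_null[OF a approximates_approx])
    then have "((\<lambda>n. \<phi> n (l1_single n (a n)) - \<phi> n (l1_single n (?b n))) \<longlongrightarrow> 0) U"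
    proof (rule Lim_null_comparison[rotated, OF tendsto_eq_rhs])
      show "\<forall>\<^sub>F n in U. norm (\<phi> n (l1_single n (a n)) - \<phi> n (l1_single n (?b n))) \<le> K * norm (a n - ?b n)"
        using \<phi> bd
      proof eventually_elim
        case (elim n)
        have "\<phi> n (l1_single n (a n)) - \<phi> n (l1_single n (?b n)) = \<phi> n (l1_single n (a n - ?b n))"
          using elim(1) by (simp add: l1_single_diff
              dual_diff[OF _ subspace_X approximates_in[OF a] approximates_in[OF approximates_approx]])
        moreover have "l1_single n (a n - ?b n) \<in> X"
          using a approximates_approx[of h]
          by (intro l1_single_in complex_vector.subspace_diff[OF subspace_Y]) (auto simp: approximates_def)
        ultimately show ?case using elim(2) norm_l1_single[of n "a n - ?b n"] by metis
      qed
    qed simp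
    from tendsto_add[OF this b] show ?thesis by simp
  qed
  then show "approximates a h \<Longrightarrow> ((\<lambda>n. \<phi> n (l1_single n (a n))) \<longlongrightarrow> dual_limit \<phi> h) U" .
  have bound: "cmod (dual_limit \<phi> h) \<le> K * norm h" for h
  proof (rule tendsto_le[OF U_nontrivial _ tendsto_norm[OF lim[OF approximates_approx]]])
    show "((\<lambda>n. K * norm (approx h n)) \<longlongrightarrow> K * norm h) U"
      using approximates_approx[of h] by (intro tendsto_intros) (simp add: approximates_def)
    show "\<forall>\<^sub>F n in U. cmod (\<phi> n (l1_single n (approx h n))) \<le> K * norm (approx h n)"
      using bd
    proof eventually_elim
      case (elim n)
      then show ?case using approximates_in[OF approximates_approx] by (metis norm_l1_single)
    qed
  qed
  then show "cmod (dual_limit \<phi> h) \<le> K * norm h" .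
  have "dual_limit \<phi> (x + y) = dual_limit \<phi> x + dual_limit \<phi> y" for x y
  proof (rule tendsto_unique[OF U_nontrivial])
    show "((\<lambda>n. \<phi> n (l1_single n (approx x n + approx y n))) \<longlongrightarrow> dual_limit \<phi> (x + y)) U"
      by (intro lim approximates_add approximates_approx)
    show "((\<lambda>n. \<phi> n (l1_single n (approx x n + approx y n))) \<longlongrightarrow> dual_limit \<phi> x + dual_limit \<phi> y) U"
    proof (rule Lim_transform_eventually[OF tendsto_add[OF lim lim]])
      show "\<forall>\<^sub>F n in U. \<phi> n (l1_single n (approx x n)) + \<phi> n (l1_single n (approx y n))
          = \<phi> n (l1_single n (approx x n + approx y n))"
        using \<phi>
        by eventually_elim (simp add: l1_single_add dualD(1) approximates_in[OF approximates_approx])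
    qed (rule approximates_approx)+
  qed
  moreover have "dual_limit \<phi> (c *\<^sub>C x) = c * dual_limit \<phi> x" for c x
  proof (rule tendsto_unique[OF U_nontrivial])
    show "((\<lambda>n. \<phi> n (l1_single n (c *\<^sub>C approx x n))) \<longlongrightarrow> dual_limit \<phi> (c *\<^sub>C x)) U"
      by (intro lim approximates_scaleC approximates_approx)
    show "((\<lambda>n. \<phi> n (l1_single n (c *\<^sub>C approx x n))) \<longlongrightarrow> c * dual_limit \<phi> x) U"
    proof (rule Lim_transform_eventually[OF tendsto_mult_left[OF lim]])
      show "\<forall>\<^sub>F n in U. c * \<phi> n (l1_single n (approx x n)) = \<phi> n (l1_single n (c *\<^sub>C approx x n))"
        using \<phi>
        by eventually_elim (simp add: l1_single_scaleC dualD(2) approximates_in[OF approximates_approx])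
    qed (rule approximates_approx)
  qed
  ultimately show "dual_limit \<phi> \<in> dual UNIV"
    using bound by (auto simp: dual_def)
qed

text \<open>The homomorphism \<open>T\<close> of the introduction.\<close>

definition ball_limit :: "('a l1seq \<Rightarrow> complex) \<Rightarrow> 'a \<Rightarrow> complex" where
  "ball_limit g = restrict0 (unit_ball UNIV) (\<lambda>y. Lim U (\<lambda>n. g (l1_single n (approx y n))))"

text \<open>Near \<open>y\<close> the functions \<open>g \<circ> l1_single n\<close> have a common Lipschitz constant, so the limit is the
  same for every approximation of \<open>y\<close>.\<close>

lemma tendsto_ball_limit:
  assumes g: "g \<in> H_infinity X" and y: "y \<in> unit_ball UNIV" and a: "approximates a y"
  shows "((\<lambda>n. g (l1_single n (a n))) \<longlongrightarrow> ball_limit g y) U"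
proof -
  obtain M where M: "M \<ge> 0" "\<And>x. cmod (g x) \<le> M" using H_infinity_bounded[OF g] by blast
  have an: "analytic_on_ball X g" using g by (simp add: H_infinity_def)
  have "((\<lambda>n. g (l1_single n (approx y n))) \<longlongrightarrow> Lim U (\<lambda>n. g (l1_single n (approx y n)))) U"
    by (rule tendsto_Lim_U[of _ M]) (simp add: M)
  then have b: "((\<lambda>n. g (l1_single n (approx y n))) \<longlongrightarrow> ball_limit g y) U"
    using y by (simp add: ball_limit_def restrict0_def)
  define r where "r = (1 - norm y) / 2"
  have r: "r > 0" "norm y < 1 - r" using y by (auto simp: r_def unit_ball_def field_simps)
  note null = approximates_diff_null[OF a approximates_approx]
  have "((\<lambda>n. 2 * M / r * norm (a n - approx y n)) \<longlongrightarrow> 2 * M / r * 0) U"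
    by (intro tendsto_mult_left null)
  then have "((\<lambda>n. g (l1_single n (a n)) - g (l1_single n (approx y n))) \<longlongrightarrow> 0) U"
  proof (rule Lim_null_comparison[rotated, OF tendsto_eq_rhs])
    have "\<forall>\<^sub>F n in U. norm (a n - approx y n) < r / 2"
      by (rule order_tendstoD(2)[OF null]) (use r in simp)
    with eventually_norm_less[OF approximates_approx r(2)]
    show "\<forall>\<^sub>F n in U. norm (g (l1_single n (a n)) - g (l1_single n (approx y n)))
        \<le> 2 * M / r * norm (a n - approx y n)"
    proof eventually_elim
      case (elim n)
      have "l1_single n (a n) \<in> X" "l1_single n (approx y n) \<in> X"
        using approximates_in a approximates_approx by auto
      with elim show ?case
        using analytic_lipschitz_bound[OF subspace_X an M(2), of "l1_single n (approx y n)" r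
            "l1_single n (a n)"] r(1)
        by (simp add: norm_l1_single l1_single_diff[symmetric])
    qed
  qed simp
  from tendsto_add[OF this b] show ?thesis by simp
qed

lemma ball_limit_eqI:
  assumes "g \<in> H_infinity X" "y \<in> unit_ball UNIV" "approximates a y"
    and "((\<lambda>n. g (l1_single n (a n))) \<longlongrightarrow> l) U"
  shows "ball_limit g y = l"
  using tendsto_unique[OF U_nontrivial tendsto_ball_limit[OF assms(1-3)] assms(4)] .

lemma ball_limit_outside: "y \<notin> unit_ball UNIV \<Longrightarrow> ball_limit g y = 0"
  by (simp add: ball_limit_def restrict0_def)

lemma ball_limit_add:
  assumes f: "f \<in> functions_of H X" and g: "g \<in> functions_of H X"
  shows "ball_limit (\<lambda>x. f x + g x) = (\<lambda>y. ball_limit f y + ball_limit g y)"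
proof
  fix y
  show "ball_limit (\<lambda>x. f x + g x) y = ball_limit f y + ball_limit g y"
    by (cases "y \<in> unit_ball UNIV")
      (auto simp: ball_limit_outside intro!: ball_limit_eqI[OF _ _ approximates_approx]
        functions_of_H_infinity[OF functions_of_add[OF subspace_X f g]] tendsto_add
        tendsto_ball_limit functions_of_H_infinity[OF f] functions_of_H_infinity[OF g] approximates_approx)
qed

lemma ball_limit_mult:
  assumes f: "f \<in> functions_of H X" and g: "g \<in> functions_of H X"
  shows "ball_limit (\<lambda>x. f x * g x) = (\<lambda>y. ball_limit f y * ball_limit g y)"
proof
  fix y
  show "ball_limit (\<lambda>x. f x * g x) y = ball_limit f y * ball_limit g y"
    by (cases "y \<in> unit_ball UNIV")
      (auto simp: ball_limit_outside intro!: ball_limit_eqI[OF _ _ approximates_approx]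
        functions_of_H_infinity[OF functions_of_mult[OF subspace_X f g]] tendsto_mult
        tendsto_ball_limit functions_of_H_infinity[OF f] functions_of_H_infinity[OF g] approximates_approx)
qed

lemma ball_limit_scale:
  assumes f: "f \<in> functions_of H X"
  shows "ball_limit (\<lambda>x. c * f x) = (\<lambda>y. c * ball_limit f y)"
proof
  fix y
  show "ball_limit (\<lambda>x. c * f x) y = c * ball_limit f y"
    by (cases "y \<in> unit_ball UNIV")
      (auto simp: ball_limit_outside intro!: ball_limit_eqI[OF _ _ approximates_approx]
        functions_of_H_infinity[OF functions_of_scale[OF subspace_X f]] tendsto_mult_left
        tendsto_ball_limit functions_of_H_infinity[OF f] approximates_approx)
qed

text \<open>The derivative at \<open>y\<close> is the limit of the derivatives of \<open>g\<close> at the points that approximate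
  \<open>y\<close>; these are bounded by Cauchy's estimate, and the quadratic remainder inequality of \<open>g\<close>, whose
  constant does not depend on \<open>n\<close>, passes to the limit. So does the modulus of uniform continuity,
  as the inclusions of the summands are isometric.\<close>

lemma ball_limit_in_functions_of:
  assumes g: "g \<in> functions_of H X"
  shows "ball_limit g \<in> functions_of H UNIV"
proof -
  have gH: "g \<in> H_infinity X" using g by (rule functions_of_H_infinity)
  then have an: "analytic_on_ball X g" by (simp add: H_infinity_def)
  obtain M where M: "M \<ge> 0" "\<And>x. cmod (g x) \<le> M" using H_infinity_bounded[OF gH] by blast
  have "quadratic_remainder_on_ball UNIV (ball_limit g)"
    unfolding quadratic_remainder_on_ball_def
  proof
    fix y :: 'a assume y: "y \<in> unit_ball UNIV"
    \<comment> \<open>Half the distance of \<open>y\<close> to the sphere: the approximating points then have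
      distance more than \<open>r\<close> from it eventually.\<close>
    define r where "r = (1 - norm y) / 2"
    have r: "r > 0" "norm y < 1 - r" using y by (auto simp: r_def unit_ball_def field_simps)
    define x where "x n = l1_single n (approx y n)" for n
    have xX: "x n \<in> X" for n unfolding x_def by (rule approximates_in[OF approximates_approx])
    define D where "D n = (SOME D. has_complex_derivative_at X g (x n) D)" for n
    have x: "\<forall>\<^sub>F n in U. norm (x n) + r < 1"
      using eventually_norm_less[OF approximates_approx r(2)]
      by eventually_elim (simp add: x_def norm_l1_single)
    then have D: "\<forall>\<^sub>F n in U. has_complex_derivative_at X g (x n) (D n)"
    proof eventually_elim
      case (elim n)
      then have "x n \<in> unit_ball X" using xX r by (simp add: unit_ball_def)
      then have "\<exists>D. has_complex_derivative_at X g (x n) D" using an by (simp add: analytic_on_ball_iff)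
      then show ?case unfolding D_def by (rule someI_ex)
    qed
    then have D1: "\<forall>\<^sub>F n in U. D n \<in> dual X"
      by eventually_elim (simp add: has_complex_derivative_at_def)
    have Mr: "M / r \<ge> 0" using M r by simp
    have D2: "\<forall>\<^sub>F n in U. \<forall>h\<in>X. cmod (D n h) \<le> M / r * norm h"
      using x D
    proof eventually_elim
      case (elim n)
      then show ?case
        using analytic_derivative_bound[OF subspace_X an M(2) xX _ r(1)] by blast
    qed
    have "cmod (ball_limit g (y + h) - ball_limit g y - dual_limit D h) \<le> 2 * M / r\<^sup>2 * (norm h)\<^sup>2"
      if h: "norm h < r / 2" for h
    proof (rule tendsto_le[OF U_nontrivial])
      have yh: "y + h \<in> unit_ball UNIV"
        using norm_triangle_ineq[of y h] h r by (simp add: unit_ball_def)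
      show "((\<lambda>n. 2 * M / r\<^sup>2 * (norm (approx h n))\<^sup>2) \<longlongrightarrow> 2 * M / r\<^sup>2 * (norm h)\<^sup>2) U"
        using approximates_approx[of h] by (intro tendsto_intros) (simp add: approximates_def)
      show "((\<lambda>n. cmod (g (l1_single n (approx y n + approx h n)) - g (l1_single n (approx y n))
            - D n (l1_single n (approx h n))))
          \<longlongrightarrow> cmod (ball_limit g (y + h) - ball_limit g y - dual_limit D h)) U"
        by (intro tendsto_norm tendsto_diff tendsto_ball_limit[OF gH] yh y
            tendsto_dual_limit[OF D1 Mr D2] approximates_add approximates_approx)
      show "\<forall>\<^sub>F n in U. cmod (g (l1_single n (approx y n + approx h n)) - g (l1_single n (approx y n))
            - D n (l1_single n (approx h n))) \<le> 2 * M / r\<^sup>2 * (norm (approx h n))\<^sup>2"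
        using x D eventually_norm_less[OF approximates_approx h]
      proof eventually_elim
        case (elim n)
        have "l1_single n (approx h n) \<in> X" by (rule approximates_in[OF approximates_approx])
        from analytic_remainder_bound[OF subspace_X an M(2) xX elim(1) r(1) elim(2) this] elim(3)
        show ?case
          by (simp add: x_def l1_single_add norm_l1_single power_divide)
      qed
    qed
    moreover have "\<forall>\<^sub>F d in at_right 0. d < r / 2"
      using eventually_at_right_real[of 0 "r / 2"] r by (auto elim: eventually_mono)
    ultimately have "\<forall>\<^sub>F d in at_right 0. \<forall>h\<in>UNIV. norm h \<le> d \<longrightarrow>
        cmod (ball_limit g (y + h) - ball_limit g y - dual_limit D h) \<le> 2 * M / r\<^sup>2 * (norm h)\<^sup>2"
      by (auto elim!: eventually_mono)
    then show "\<exists>D\<in>dual UNIV. \<exists>C. \<forall>\<^sub>F d in at_right 0. \<forall>h\<in>UNIV. norm h \<le> d \<longrightarrow>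
        cmod (ball_limit g (y + h) - ball_limit g y - D h) \<le> C * (norm h)\<^sup>2"
      using dual_limit_in_dual[OF D1 Mr D2] by blast
  qed
  moreover have "cmod (ball_limit g y) \<le> M" if "y \<in> unit_ball UNIV" for y
    by (rule tendsto_upperbound[OF tendsto_norm[OF tendsto_ball_limit[OF gH that approximates_approx]]])
      (auto simp: M U_nontrivial)
  then have "bounded (ball_limit g ` unit_ball UNIV)" by (auto simp: bounded_iff)
  moreover have "uniformly_continuous_on (unit_ball UNIV) (ball_limit g)" if "H = Uniform_Algebra"
    unfolding uniformly_continuous_on_def
  proof (intro allI impI)
    fix e :: real assume e: "e > 0"
    have "uniformly_continuous_on (unit_ball X) g"
      using g that by (simp add: A_u_def)
    then obtain d where d: "d > 0"
      "\<forall>x\<in>unit_ball X. \<forall>x'\<in>unit_ball X. dist x' x < d \<longrightarrow> dist (g x') (g x) < e / 2"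
      using e unfolding uniformly_continuous_on_def by (meson half_gt_zero)
    have "dist (ball_limit g y') (ball_limit g y) < e"
      if y: "y \<in> unit_ball UNIV" "y' \<in> unit_ball UNIV" "dist y' y < d" for y y'
    proof -
      have "dist (ball_limit g y') (ball_limit g y) \<le> e / 2"
      proof (rule tendsto_upperbound)
        show "((\<lambda>n. dist (g (l1_single n (approx y' n))) (g (l1_single n (approx y n))))
            \<longlongrightarrow> dist (ball_limit g y') (ball_limit g y)) U"
          by (intro tendsto_dist tendsto_ball_limit[OF gH] y approximates_approx)
        have "((\<lambda>n. dist (approx y' n) (approx y n)) \<longlongrightarrow> dist y' y) U"
          using approximates_approx by (intro tendsto_dist) (auto simp: approximates_def)
        then have "\<forall>\<^sub>F n in U. dist (approx y' n) (approx y n) < d"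
          using order_tendstoD(2) y(3) by blast
        moreover have "\<forall>\<^sub>F n in U. norm (approx z n) < 1" if "z \<in> unit_ball UNIV" for z
          using that by (intro eventually_norm_less[OF approximates_approx]) (simp add: unit_ball_def)
        note this[OF y(1)] this[OF y(2)]
        ultimately show "\<forall>\<^sub>F n in U. dist (g (l1_single n (approx y' n))) (g (l1_single n (approx y n))) \<le> e / 2"
        proof eventually_elim
          case (elim n)
          then show ?case
            using d(2)[rule_format, of "l1_single n (approx y n)" "l1_single n (approx y' n)"]
              approximates_in[OF approximates_approx]
            by (simp add: unit_ball_def norm_l1_single dist_norm l1_single_diff[symmetric])
        qed
      qed (rule U_nontrivial)
      then show ?thesis using e by simp
    qed
    then show "\<exists>d>0. \<forall>x\<in>unit_ball UNIV. \<forall>x'\<in>unit_ball UNIV. dist x' x < d \<longrightarrow>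
        dist (ball_limit g x') (ball_limit g x) < e"
      using d(1) by blast
  qed
  ultimately show ?thesis
    by (simp add: functions_of_iff[OF complex_vector.subspace_UNIV] ball_limit_outside)
qed

text \<open>The homomorphism \<open>f \<mapsto> f \<circ> Q\<close> of the introduction.\<close>

definition pullback :: "('a \<Rightarrow> complex) \<Rightarrow> 'a l1seq \<Rightarrow> complex" where
  "pullback f = restrict0 (unit_ball X) (\<lambda>z. f (l1_total z))"

lemma l1_total_unit_ball: "z \<in> unit_ball X \<Longrightarrow> l1_total z \<in> unit_ball UNIV"
  using norm_l1_total_le[of z] by (simp add: unit_ball_def)

lemma restrict0_total_in_dual:
  assumes \<phi>: "\<phi> \<in> dual UNIV"
  shows "restrict0 X (\<lambda>z. \<phi> (l1_total z)) \<in> dual X"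
proof -
  obtain K where K: "K \<ge> 0" "\<And>x. cmod (\<phi> x) \<le> K * norm x"
    using dual_bounded[OF \<phi>] by auto
  have "cmod (\<phi> (l1_total z)) \<le> K * norm z" for z
    using order_trans[OF K(2) mult_left_mono[OF norm_l1_total_le K(1)]] .
  then have "\<exists>K. \<forall>z\<in>X. cmod (\<phi> (l1_total z)) \<le> K * norm z" by blast
  then show ?thesis
    by (auto simp: dual_def restrict0_def l1_total_add l1_total_scaleC dualD[OF \<phi>]
        complex_vector.subspace_add[OF subspace_X] complex_vector.subspace_scale[OF subspace_X])
qed

lemma pullback_in_functions_of:
  assumes f: "f \<in> functions_of H UNIV"
  shows "pullback f \<in> functions_of H X"
proof -
  note f' = f[unfolded functions_of_iff[OF complex_vector.subspace_UNIV]]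
  obtain M where M: "\<And>x. cmod (f x) \<le> M"
    using H_infinity_bounded[OF functions_of_H_infinity[OF f]] by blast
  have "quadratic_remainder_on_ball X (pullback f)"
    unfolding quadratic_remainder_on_ball_def
  proof
    fix z assume z: "z \<in> unit_ball X"
    obtain D C where D: "D \<in> dual UNIV" and C:
      "\<forall>\<^sub>F d in at_right 0. \<forall>h. norm h \<le> d \<longrightarrow>
        cmod (f (l1_total z + h) - f (l1_total z) - D h) \<le> C * (norm h)\<^sup>2"
      using f' l1_total_unit_ball[OF z] by (auto simp: quadratic_remainder_on_ball_def)
    have "\<forall>\<^sub>F d in at_right 0. d < 1 - norm z"
      using z eventually_at_right_real[of 0 "1 - norm z"]
      by (auto simp: unit_ball_def elim: eventually_mono)
    with C have "\<forall>\<^sub>F d in at_right 0. \<forall>h\<in>X. norm h \<le> d \<longrightarrow>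
        cmod (pullback f (z + h) - pullback f z - restrict0 X (\<lambda>z. D (l1_total z)) h)
          \<le> \<bar>C\<bar> * (norm h)\<^sup>2"
    proof eventually_elim
      case (elim d)
      show ?case
      proof (intro ballI impI)
        fix h assume h: "h \<in> X" "norm h \<le> d"
        have zh: "z + h \<in> unit_ball X"
          using norm_triangle_ineq[of z h] h z elim
          by (simp add: unit_ball_def complex_vector.subspace_add[OF subspace_X])
        have "cmod (f (l1_total z + l1_total h) - f (l1_total z) - D (l1_total h))
            \<le> C * (norm (l1_total h))\<^sup>2"
          using elim h norm_l1_total_le[of h] by auto
        also have "\<dots> \<le> \<bar>C\<bar> * (norm h)\<^sup>2"
          by (intro mult_mono power_mono norm_l1_total_le) auto
        finally show "cmod (pullback f (z + h) - pullback f z - restrict0 X (\<lambda>z. D (l1_total z)) h)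
          \<le> \<bar>C\<bar> * (norm h)\<^sup>2"
          using z zh h by (simp add: pullback_def restrict0_def l1_total_add)
      qed
    qed
    then show "\<exists>D\<in>dual X. \<exists>C. \<forall>\<^sub>F d in at_right 0. \<forall>h\<in>X. norm h \<le> d \<longrightarrow>
        cmod (pullback f (z + h) - pullback f z - D h) \<le> C * (norm h)\<^sup>2"
      using restrict0_total_in_dual[OF D] by blast
  qed
  moreover have "bounded (pullback f ` unit_ball X)"
    using M by (auto simp: bounded_iff pullback_def restrict0_def)
  moreover have "uniformly_continuous_on (unit_ball X) (pullback f)" if H: "H = Uniform_Algebra"
    unfolding uniformly_continuous_on_def
  proof (intro allI impI)
    fix e :: real assume "e > 0"
    then obtain d where d: "d > 0"
      "\<forall>x\<in>unit_ball UNIV. \<forall>x'\<in>unit_ball UNIV. dist x' x < d \<longrightarrow> dist (f x') (f x) < e"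
      using f' H unfolding uniformly_continuous_on_def by blast
    have "dist (l1_total z') (l1_total z) \<le> dist z' z" for z z' :: "'a l1seq"
      using norm_l1_total_le[of "z' - z"] by (simp add: dist_norm l1_total_diff)
    from order_le_less_trans[OF this]
    have "dist (pullback f z') (pullback f z) < e"
      if "z \<in> unit_ball X" "z' \<in> unit_ball X" "dist z' z < d" for z z'
      using d(2) that l1_total_unit_ball by (simp add: pullback_def restrict0_def)
    then show "\<exists>d>0. \<forall>x\<in>unit_ball X. \<forall>x'\<in>unit_ball X. dist x' x < d \<longrightarrow>
        dist (pullback f x') (pullback f x) < e"
      using d(1) by blast
  qed
  ultimately show ?thesis
    by (simp add: functions_of_iff[OF subspace_X] pullback_def restrict0_def)
qed

text \<open>On \<open>Y n\<close> the inclusion of the \<open>n\<close>-th summand is a right inverse of summation, so the limit is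
  that of \<open>f\<close> along an approximation of \<open>y\<close>, where \<open>f\<close> is continuous.\<close>

lemma ball_limit_pullback:
  assumes f: "f \<in> functions_of H UNIV"
  shows "ball_limit (pullback f) = f"
proof
  fix y
  have fH: "f \<in> H_infinity UNIV" by (rule functions_of_H_infinity[OF f])
  show "ball_limit (pullback f) y = f y"
  proof (cases "y \<in> unit_ball UNIV")
    case True
    define r where "r = (1 - norm y) / 2"
    have r: "r > 0" "norm y + r < 1" using True by (auto simp: r_def unit_ball_def field_simps)
    obtain M where M: "M \<ge> 0" "\<And>x. cmod (f x) \<le> M" using H_infinity_bounded[OF fH] by blast
    note a = approximates_approx[of y]
    have "((\<lambda>n. approx y n - y) \<longlongrightarrow> 0) U"
      using a by (auto simp: approximates_def intro: tendsto_eq_rhs[OF tendsto_diff])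
    note null = tendsto_norm_zero[OF this]
    have "((\<lambda>n. 2 * M / r * norm (approx y n - y)) \<longlongrightarrow> 2 * M / r * 0) U"
      by (intro tendsto_mult_left null)
    then have "((\<lambda>n. f (approx y n) - f y) \<longlongrightarrow> 0) U"
    proof (rule Lim_null_comparison[rotated, OF tendsto_eq_rhs])
      have "\<forall>\<^sub>F n in U. norm (approx y n - y) < r / 2"
        by (rule order_tendstoD(2)[OF null]) (use r in simp)
      then show "\<forall>\<^sub>F n in U. norm (f (approx y n) - f y) \<le> 2 * M / r * norm (approx y n - y)"
      proof eventually_elim
        case (elim n)
        have "analytic_on_ball UNIV f" using fH by (simp add: H_infinity_def)
        from analytic_lipschitz_bound[OF complex_vector.subspace_UNIV this M(2) UNIV_I r(2,1) UNIV_I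
            less_imp_le[OF elim]]
        show ?case .
      qed
    qed simp
    then have "((\<lambda>n. f (approx y n)) \<longlongrightarrow> f y) U" by (simp add: Lim_null[symmetric])
    moreover have "\<forall>\<^sub>F n in U. norm (approx y n) < 1"
      using True by (intro eventually_norm_less[OF a]) (simp add: unit_ball_def)
    then have "\<forall>\<^sub>F n in U. f (approx y n) = pullback f (l1_single n (approx y n))"
      by eventually_elim (simp add: pullback_def restrict0_def unit_ball_def norm_l1_single
          l1_total_single approximates_in[OF a])
    ultimately have "((\<lambda>n. pullback f (l1_single n (approx y n))) \<longlongrightarrow> f y) U"
      by (rule Lim_transform_eventually)
    then show ?thesis
      by (rule ball_limit_eqI[OF functions_of_H_infinity[OF pullback_in_functions_of[OF f]] True a])
  next
    case False
    then show ?thesis using fH by (simp add: ball_limit_outside H_infinity_def)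
  qed
qed

abbreviation dual_lim :: "('a l1seq \<Rightarrow> complex) \<Rightarrow> 'a \<Rightarrow> complex" where
  "dual_lim \<phi> \<equiv> dual_limit (\<lambda>_. \<phi>)"

lemma
  assumes \<phi>: "\<phi> \<in> dual X"
  shows tendsto_dual_lim: "approximates a h \<Longrightarrow> ((\<lambda>n. \<phi> (l1_single n (a n))) \<longlongrightarrow> dual_lim \<phi> h) U"
    and norm_dual_lim: "cmod (dual_lim \<phi> h) \<le> dual_norm X \<phi> * norm h"
    and dual_lim_in_dual: "dual_lim \<phi> \<in> dual UNIV"
  using tendsto_dual_limit[of "\<lambda>_. \<phi>"] norm_dual_limit[of "\<lambda>_. \<phi>"] dual_limit_in_dual[of "\<lambda>_. \<phi>"]
    \<phi> dual_norm_nonneg[OF subspace_X \<phi>] norm_le_dual_norm_mult[OF subspace_X \<phi>]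
  by (auto simp: eventually_const_iff)

lemma dual_norm_dual_lim_le: "\<phi> \<in> dual X \<Longrightarrow> dual_norm UNIV (dual_lim \<phi>) \<le> dual_norm X \<phi>"
  by (intro dual_norm_le norm_dual_lim dual_norm_nonneg[OF subspace_X]) auto

lemma dual_lim_eqI:
  assumes "\<phi> \<in> dual X" "approximates a h" "((\<lambda>n. \<phi> (l1_single n (a n))) \<longlongrightarrow> l) U"
  shows "dual_lim \<phi> h = l"
  using tendsto_unique[OF U_nontrivial tendsto_dual_lim[OF assms(1,2)] assms(3)] .

lemma dual_lim_add:
  assumes "\<phi> \<in> dual X" "\<psi> \<in> dual X"
  shows "dual_lim (\<lambda>x. \<phi> x + \<psi> x) = (\<lambda>h. dual_lim \<phi> h + dual_lim \<psi> h)"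
  by (intro ext dual_lim_eqI[OF _ approximates_approx] tendsto_add tendsto_dual_lim
      dual_add assms approximates_approx)

lemma dual_lim_mult:
  assumes "\<phi> \<in> dual X"
  shows "dual_lim (\<lambda>x. c * \<phi> x) = (\<lambda>h. c * dual_lim \<phi> h)"
  by (intro ext dual_lim_eqI[OF _ approximates_approx] tendsto_mult_left tendsto_dual_lim
      dual_mult assms approximates_approx)

lemma dual_lim_pullback:
  assumes \<phi>: "\<phi> \<in> dual UNIV"
  shows "dual_lim (restrict0 X (\<lambda>z. \<phi> (l1_total z))) = \<phi>"
proof (intro ext dual_lim_eqI[OF restrict0_total_in_dual[OF \<phi>] approximates_approx])
  fix h
  obtain K where K: "\<And>x. cmod (\<phi> x) \<le> K * norm x" using dual_bounded[OF \<phi>] by auto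
  have "((\<lambda>n. approx h n - h) \<longlongrightarrow> 0) U"
    using approximates_approx[of h] by (auto simp: approximates_def intro: tendsto_eq_rhs[OF tendsto_diff])
  from tendsto_mult_left[OF tendsto_norm_zero[OF this], of K]
  have "((\<lambda>n. \<phi> (approx h n) - \<phi> h) \<longlongrightarrow> 0) U"
    by (rule Lim_null_comparison[rotated, OF tendsto_eq_rhs])
      (use K in \<open>auto simp: dual_diff[OF \<phi> complex_vector.subspace_UNIV, symmetric]\<close>)
  then show "((\<lambda>n. restrict0 X (\<lambda>z. \<phi> (l1_total z)) (l1_single n (approx h n))) \<longlongrightarrow> \<phi> h) U"
    by (simp add: restrict0_def approximates_in[OF approximates_approx] l1_total_single Lim_null[symmetric])
qed

lemma ball_limit_restrict_dual:
  assumes \<phi>: "\<phi> \<in> dual X"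
  shows "ball_limit (restrict0 (unit_ball X) \<phi>) = restrict0 (unit_ball UNIV) (dual_lim \<phi>)"
proof
  fix y
  show "ball_limit (restrict0 (unit_ball X) \<phi>) y = restrict0 (unit_ball UNIV) (dual_lim \<phi>) y"
  proof (cases "y \<in> unit_ball UNIV")
    case True
    have "\<forall>\<^sub>F n in U. norm (approx y n) < 1"
      using True by (intro eventually_norm_less[OF approximates_approx]) (simp add: unit_ball_def)
    then have "\<forall>\<^sub>F n in U. \<phi> (l1_single n (approx y n))
        = restrict0 (unit_ball X) \<phi> (l1_single n (approx y n))"
      by eventually_elim (simp add: restrict0_def unit_ball_def norm_l1_single
          approximates_in[OF approximates_approx])
    with tendsto_dual_lim[OF \<phi> approximates_approx]
    have "((\<lambda>n. restrict0 (unit_ball X) \<phi> (l1_single n (approx y n))) \<longlongrightarrow> dual_lim \<phi> y) U"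
      by (rule Lim_transform_eventually)
    from ball_limit_eqI[OF functions_of_H_infinity[OF dual_in_functions_of[OF subspace_X \<phi>, of Bounded_Algebra]]
        True approximates_approx this]
    show ?thesis using True by (simp add: restrict0_def)
  qed (simp add: ball_limit_outside restrict0_def)
qed

section \<open>Lifting points and characters to the l1 sum\<close>

text \<open>The functional \<open>y\<close> composed with the contraction \<open>dual_lim\<close> from the dual of \<open>X\<close> to the dual
  of \<open>'a\<close>. By \<open>dual_lim_pullback\<close>, the second adjoint of summation maps it back to \<open>y\<close>.\<close>

definition lift_bidual :: "(('a \<Rightarrow> complex) \<Rightarrow> complex) \<Rightarrow> ('a l1seq \<Rightarrow> complex) \<Rightarrow> complex" where
  "lift_bidual y = restrict0 (dual X) (\<lambda>\<phi>. y (dual_lim \<phi>))"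

lemma lift_bidual_in_bidual_cball:
  assumes y: "y \<in> bidual_cball UNIV"
  shows "lift_bidual y \<in> bidual_cball X"
proof -
  have y1: "y (\<lambda>x. \<phi> x + \<psi> x) = y \<phi> + y \<psi>" if "\<phi> \<in> dual UNIV" "\<psi> \<in> dual UNIV" for \<phi> \<psi>
    using y that by (simp add: bidual_cball_def bidual_def)
  have y2: "y (\<lambda>x. c * \<phi> x) = c * y \<phi>" if "\<phi> \<in> dual UNIV" for c \<phi>
    using y that by (simp add: bidual_cball_def bidual_def)
  obtain K where K: "\<And>\<phi>. \<phi> \<in> dual UNIV \<Longrightarrow> cmod (y \<phi>) \<le> K * dual_norm UNIV \<phi>"
    using y unfolding bidual_cball_def bidual_def by blast
  have K': "cmod (y \<phi>) \<le> \<bar>K\<bar> * dual_norm UNIV \<phi>" if "\<phi> \<in> dual UNIV" for \<phi>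
    using K[OF that] mult_right_mono[OF abs_ge_self[of K]
        dual_norm_nonneg[OF complex_vector.subspace_UNIV that]] by linarith
  have "cmod (y (dual_lim \<phi>)) \<le> \<bar>K\<bar> * dual_norm X \<phi>" if "\<phi> \<in> dual X" for \<phi>
    using K'[OF dual_lim_in_dual[OF that]]
      mult_left_mono[OF dual_norm_dual_lim_le[OF that], of "\<bar>K\<bar>"] by linarith
  then have "\<exists>K. \<forall>\<phi>\<in>dual X. cmod (y (dual_lim \<phi>)) \<le> K * dual_norm X \<phi>" by blast
  then have "lift_bidual y \<in> bidual X"
    by (auto simp: bidual_def lift_bidual_def restrict0_def dual_add dual_mult dual_lim_add
        dual_lim_mult y1 y2 dual_lim_in_dual)
  moreover have "bidual_norm X (lift_bidual y) \<le> 1"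
    unfolding bidual_norm_def
  proof (rule cSUP_least)
    have "(\<lambda>_. 0) \<in> dual X" by (auto simp: dual_def intro: exI[of _ 0])
    moreover have "dual_norm X (\<lambda>_. 0) \<le> 1"
      by (rule dual_norm_le) (auto simp: complex_vector.subspace_0[OF subspace_X])
    ultimately show "{\<phi>\<in>dual X. dual_norm X \<phi> \<le> 1} \<noteq> {}" by blast
    fix \<phi> assume "\<phi> \<in> {\<phi>\<in>dual X. dual_norm X \<phi> \<le> 1}"
    then have \<phi>: "\<phi> \<in> dual X" "dual_norm UNIV (dual_lim \<phi>) \<le> 1"
      using dual_norm_dual_lim_le[of \<phi>] by auto
    have "cmod (y (dual_lim \<phi>)) \<le> bidual_norm UNIV y"
      unfolding bidual_norm_def
    proof (rule cSUP_upper)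
      show "bdd_above ((\<lambda>\<phi>. cmod (y \<phi>)) ` {\<phi> \<in> dual UNIV. dual_norm UNIV \<phi> \<le> 1})"
      proof (rule bdd_aboveI2)
        fix \<psi> :: "'a \<Rightarrow> complex" assume "\<psi> \<in> {\<phi> \<in> dual UNIV. dual_norm UNIV \<phi> \<le> 1}"
        then show "cmod (y \<psi>) \<le> \<bar>K\<bar>"
          using K'[of \<psi>] mult_left_mono[of "dual_norm UNIV \<psi>" 1 "\<bar>K\<bar>"] by auto
      qed
    qed (use \<phi> dual_lim_in_dual in auto)
    also have "\<dots> \<le> 1" using y by (simp add: bidual_cball_def)
    finally show "cmod (lift_bidual y \<phi>) \<le> 1" using \<phi> by (simp add: lift_bidual_def restrict0_def)
  qed
  ultimately show ?thesis by (simp add: bidual_cball_def)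
qed

text \<open>The lift is a character because \<open>ball_limit\<close> is a homomorphism of algebras, nonzero because
  \<open>ball_limit\<close> maps pullbacks onto the whole algebra, and it lies over \<open>lift_bidual y\<close> because
  \<open>ball_limit\<close> acts on functionals as \<open>dual_lim\<close>.\<close>

lemma lift_character_in_fiber:
  assumes \<tau>: "\<tau> \<in> fiber H UNIV y"
  shows "restrict0 (functions_of H X) (\<lambda>g. \<tau> (ball_limit g)) \<in> fiber H X (lift_bidual y)"
proof -
  let ?\<sigma> = "restrict0 (functions_of H X) (\<lambda>g. \<tau> (ball_limit g))"
  have char: "\<tau> \<in> characters (functions_of H UNIV)" using \<tau> by (simp add: fiber_def)
  have "\<exists>f\<in>functions_of H UNIV. \<tau> f \<noteq> 0" using char unfolding characters_def by blast
  then have "\<exists>g\<in>functions_of H X. ?\<sigma> g \<noteq> 0"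
    using pullback_in_functions_of ball_limit_pullback by (force simp: restrict0_def)
  moreover have "?\<sigma> (\<lambda>x. f x + g x) = ?\<sigma> f + ?\<sigma> g" "?\<sigma> (\<lambda>x. f x * g x) = ?\<sigma> f * ?\<sigma> g"
    if "f \<in> functions_of H X" "g \<in> functions_of H X" for f g
    using char ball_limit_in_functions_of[OF that(1)] ball_limit_in_functions_of[OF that(2)] that
    by (simp_all add: restrict0_def functions_of_add[OF subspace_X] functions_of_mult[OF subspace_X]
        ball_limit_add ball_limit_mult characters_def)
  moreover have "?\<sigma> (\<lambda>x. c * f x) = c * ?\<sigma> f" if "f \<in> functions_of H X" for c f
    using char ball_limit_in_functions_of[OF that] that
    by (simp add: restrict0_def functions_of_scale[OF subspace_X] ball_limit_scale characters_def)
  ultimately have "?\<sigma> \<in> characters (functions_of H X)"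
    unfolding characters_def by (auto simp: restrict0_def)
  moreover have "?\<sigma> (restrict0 (unit_ball X) \<phi>) = lift_bidual y \<phi>" if "\<phi> \<in> dual X" for \<phi>
  proof -
    have "?\<sigma> (restrict0 (unit_ball X) \<phi>) = \<tau> (restrict0 (unit_ball UNIV) (dual_lim \<phi>))"
      using dual_in_functions_of[OF subspace_X that]
      by (simp add: restrict0_def[of "functions_of H X"] ball_limit_restrict_dual[OF that])
    also have "\<dots> = y (dual_lim \<phi>)"
      using \<tau> dual_lim_in_dual[OF that] by (simp add: fiber_def)
    finally show ?thesis using that by (simp add: lift_bidual_def restrict0_def)
  qed
  ultimately show ?thesis by (simp add: fiber_def)
qed

text \<open>The image under summation of a filter converging weak-star to \<open>lift_bidual y\<close> converges
  weak-star to \<open>y\<close>, because a functional \<open>\<phi>\<close> on \<open>'a\<close> pulls back to one whose \<open>dual_lim\<close> is \<open>\<phi>\<close>.\<close>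

lemma cluster_set_pullback:
  "cluster_set X (pullback f) (lift_bidual y) \<subseteq> cluster_set UNIV f y"
proof
  fix l assume "l \<in> cluster_set X (pullback f) (lift_bidual y)"
  then obtain F where F: "F \<noteq> bot" "\<forall>\<^sub>F z in F. z \<in> unit_ball X"
    "\<And>\<phi>. \<phi> \<in> dual X \<Longrightarrow> (\<phi> \<longlongrightarrow> lift_bidual y \<phi>) F" "(pullback f \<longlongrightarrow> l) F"
    unfolding cluster_set_def by blast
  let ?G = "filtermap l1_total F"
  have "?G \<noteq> bot" using F(1) by (simp add: filtermap_bot_iff)
  moreover have "\<forall>\<^sub>F x in ?G. x \<in> unit_ball UNIV"
    unfolding eventually_filtermap using F(2) by eventually_elim (rule l1_total_unit_ball)
  moreover have "(\<phi> \<longlongrightarrow> y \<phi>) ?G" if \<phi>: "\<phi> \<in> dual UNIV" for \<phi>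
  proof -
    let ?\<psi> = "restrict0 X (\<lambda>z. \<phi> (l1_total z))"
    have \<psi>: "?\<psi> \<in> dual X" by (rule restrict0_total_in_dual[OF \<phi>])
    have "lift_bidual y ?\<psi> = y (dual_lim ?\<psi>)"
      using \<psi> by (simp only: lift_bidual_def restrict0_def[of "dual X"] if_True)
    then have "(?\<psi> \<longlongrightarrow> y \<phi>) F" using F(3)[OF \<psi>] by (simp add: dual_lim_pullback[OF \<phi>])
    moreover have "\<forall>\<^sub>F z in F. ?\<psi> z = \<phi> (l1_total z)"
      using F(2) by eventually_elim (simp add: restrict0_def unit_ball_def)
    ultimately have "((\<lambda>z. \<phi> (l1_total z)) \<longlongrightarrow> y \<phi>) F" by (rule Lim_transform_eventually)
    then show ?thesis by (simp add: filterlim_filtermap)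
  qed
  moreover have "(f \<longlongrightarrow> l) ?G"
  proof -
    have "\<forall>\<^sub>F z in F. pullback f z = f (l1_total z)"
      using F(2) by eventually_elim (simp add: pullback_def restrict0_def)
    with F(4) have "((\<lambda>z. f (l1_total z)) \<longlongrightarrow> l) F" by (rule Lim_transform_eventually)
    then show ?thesis by (simp add: filterlim_filtermap)
  qed
  ultimately show "l \<in> cluster_set UNIV f y" unfolding cluster_set_def by blast
qed

lemma cluster_value_theorem_transfer:
  assumes "cluster_value_theorem_at H X (lift_bidual y)"
  shows "cluster_value_theorem_at H UNIV y"
  unfolding cluster_value_theorem_at_def
proof (intro ballI subsetI)
  fix f l assume f: "f \<in> functions_of H UNIV" and "l \<in> {\<tau> f |\<tau>. \<tau> \<in> fiber H UNIV y}"
  then obtain \<tau> where \<tau>: "\<tau> \<in> fiber H UNIV y" and l: "l = \<tau> f" by blast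
  define \<sigma> where "\<sigma> = restrict0 (functions_of H X) (\<lambda>g. \<tau> (ball_limit g))"
  have pf: "pullback f \<in> functions_of H X" by (rule pullback_in_functions_of[OF f])
  have "\<sigma> (pullback f) = l"
    using pf by (simp add: \<sigma>_def restrict0_def ball_limit_pullback[OF f] l)
  moreover have "\<sigma> \<in> fiber H X (lift_bidual y)"
    unfolding \<sigma>_def by (rule lift_character_in_fiber[OF \<tau>])
  ultimately have "l \<in> cluster_set X (pullback f) (lift_bidual y)"
    using assms pf unfolding cluster_value_theorem_at_def by blast
  then show "l \<in> cluster_set UNIV f y" using cluster_set_pullback by blast
qed

end

theorem theorem2p4:
  fixes Y :: "nat \<Rightarrow> 'a :: cbanach set" and H :: ball_algebra
  assumes separable: "separable_space (euclidean :: 'a topology)"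
    and finite_dim: "\<And>n. finite_dim_csubspace (Y n)"
    and increasing: "\<And>n. Y n \<subseteq> Y (Suc n)"
    and dense: "closure (\<Union>n. Y n) = UNIV"
    and cluster_X: "\<And>x. x \<in> bidual_cball (l1_sum Y) \<Longrightarrow>
                      cluster_value_theorem_at H (l1_sum Y) x"
    and y: "y \<in> bidual_cball (UNIV :: 'a set)"
  shows "cluster_value_theorem_at H (UNIV :: 'a set) y"
proof -
  obtain U :: "nat filter" where U: "U \<noteq> bot" "U \<le> sequentially"
    "\<And>s :: nat \<Rightarrow> complex. bounded (range s) \<Longrightarrow> \<exists>l. (s \<longlongrightarrow> l) U"
    using ex_filter_bounded_convergent by blast
  have "complex_vector.subspace (Y n)" for n
    using finite_dim[of n] by (auto simp: finite_dim_csubspace_def complex_vector.subspace_span)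
  then interpret dense_exhaustion Y U
    using increasing dense U by unfold_locales auto
  show ?thesis
    by (intro cluster_value_theorem_transfer cluster_X lift_bidual_in_bidual_cball y)
qed

end
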